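(* For any non-recursive RE Turing degree $\mathbf{d}$, one can effectively find a consistent RE theory $T_{\mathbf{d}}$ such that $T_{\mathbf{d}}$ does not interpret $\mathbf{R}$, $T_{\mathbf{d}}$ is RI, $T_{\mathbf{d}}$ is TP, and $T_{\mathbf{d}}$ has Turing degree $\mathbf{d}$.
   Context: $T_P=\{\ulcorner\phi\urcorner:T\vdash\phi\}$, $T_R=\{\ulcorner\phi\urcorner:T\vdash\neg\phi\}$. A theory $T$ is RI if there is no recursive set $X$ with $T_P\subseteq X$ and $X\cap T_R=\emptyset$; TP (Turing persistent) if $T$ is undecidable and $T\le_T S$ for every consistent RE extension $S$ of $T$. "Interprets" is relative interpretation. $\mathbf{R}$ is the theory in language $\{\mathbf{0},\mathbf{S},+,\cdot,\le\}$ ($x\le y$ meaning $\exists z(z+x=y)$, $\overline{n}=\mathbf{S}^n\mathbf{0}$) with axiom schemes $\overline{m}+\overline{n}=\overline{m+n}$, $\overline{m}\cdot\overline{n}=\overline{m\cdot n}$, $\overline{m}\ne\overline{n}$ ($m\ne n$), $\forall x(x\le\overline{n}\to x=\overline{0}\vee\dots\vee x=\overline{n})$, $\forall x(x\le\overline{n}\vee\overline{n}\le x)$. *)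

theory Defs
  imports Main "HOL-Library.Nat_Bijection"
begin

section \<open>Relative computability\<close>

text \<open>Kleene's (partial) recursive functions over tuples of naturals, with an oracle symbol.\<close>

datatype prog =
    PZero
  | PSucc
  | PProj nat
  | POracle
  | PComp prog "prog list"
  | PPrec prog prog
  | PMu prog

text \<open>\<open>computes X p xs y\<close>: with oracle set \<open>X\<close>, program \<open>p\<close> halts on input \<open>xs\<close> with output \<open>y\<close>.
  Ill-formed calls (wrong number of arguments) diverge.\<close>

inductive computes :: "nat set \<Rightarrow> prog \<Rightarrow> nat list \<Rightarrow> nat \<Rightarrow> bool" for X :: "nat set" where
  zero: "computes X PZero xs 0"
| succ: "computes X PSucc [x] (Suc x)"
| proj: "i < length xs \<Longrightarrow> computes X (PProj i) xs (xs ! i)"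
| orac: "computes X POracle [x] (if x \<in> X then 1 else 0)"
| comp: "list_all2 (\<lambda>g y. computes X g xs y) gs ys \<Longrightarrow> computes X f ys z
           \<Longrightarrow> computes X (PComp f gs) xs z"
| prec_0: "computes X f xs y \<Longrightarrow> computes X (PPrec f g) (0 # xs) y"
| prec_Suc: "computes X (PPrec f g) (n # xs) r \<Longrightarrow> computes X g (n # r # xs) y
           \<Longrightarrow> computes X (PPrec f g) (Suc n # xs) y"
| mu: "computes X f (n # xs) 0 \<Longrightarrow> (\<forall>m<n. \<exists>k. computes X f (m # xs) (Suc k))
           \<Longrightarrow> computes X (PMu f) xs n"

primrec prog_code :: "prog \<Rightarrow> nat" where
  "prog_code PZero = prod_encode (0, 0)"
| "prog_code PSucc = prod_encode (1, 0)"
| "prog_code (PProj i) = prod_encode (2, i)"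
| "prog_code POracle = prod_encode (3, 0)"
| "prog_code (PComp f gs) =
     prod_encode (4, prod_encode (prog_code f, list_encode (map prog_code gs)))"
| "prog_code (PPrec f g) = prod_encode (5, prod_encode (prog_code f, prog_code g))"
| "prog_code (PMu f) = prod_encode (6, prog_code f)"

definition computes_char :: "nat set \<Rightarrow> prog \<Rightarrow> nat set \<Rightarrow> bool" where
  "computes_char X p A \<longleftrightarrow> (\<forall>x. computes X p [x] (if x \<in> A then 1 else 0))"

text \<open>Absence of an oracle is rendered as the empty oracle; \<open>POracle\<close> then merely computes the
  constant 0.\<close>

definition recursive_fun :: "(nat \<Rightarrow> nat) \<Rightarrow> bool" where
  "recursive_fun f \<longleftrightarrow> (\<exists>p. \<forall>x. computes {} p [x] (f x))"

definition recursive_set :: "nat set \<Rightarrow> bool" where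
  "recursive_set A \<longleftrightarrow> (\<exists>p. computes_char {} p A)"

definition decision_index :: "nat \<Rightarrow> nat set \<Rightarrow> bool" where
  "decision_index i A \<longleftrightarrow> (\<exists>p. prog_code p = i \<and> computes_char {} p A)"

text \<open>The \<open>e\<close>-th RE set; it is empty if \<open>e\<close> is not the code of a program.\<close>

definition W :: "nat \<Rightarrow> nat set" where
  "W e = {x. \<exists>p y. prog_code p = e \<and> computes {} p [x] y}"

definition RE_set :: "nat set \<Rightarrow> bool" where
  "RE_set A \<longleftrightarrow> (\<exists>e. A = W e)"

definition turing_le :: "nat set \<Rightarrow> nat set \<Rightarrow> bool" (infix "\<le>\<^sub>T" 50) where
  "A \<le>\<^sub>T B \<longleftrightarrow> (\<exists>p. computes_char B p A)"

definition turing_degree :: "nat set \<Rightarrow> nat set set" where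
  "turing_degree A = {B. B \<le>\<^sub>T A \<and> A \<le>\<^sub>T B}"

definition RE_degree :: "nat set set \<Rightarrow> bool" where
  "RE_degree d \<longleftrightarrow> (\<exists>A. RE_set A \<and> d = turing_degree A)"

definition recursive_degree :: "nat set set \<Rightarrow> bool" where
  "recursive_degree d \<longleftrightarrow> (\<exists>A. recursive_set A \<and> d = turing_degree A)"


section \<open>First-order logic with equality\<close>

text \<open>De Bruijn indices. A symbol is a name together with the number of arguments it is applied
  to, so the same name with different arities stands for different symbols. Arity 0 is
  allowed.\<close>

datatype tm = Var nat | Fun nat "tm list"

datatype fm = Falsum | Eq tm tm | Rel nat "tm list" | Imp fm fm | All fm

abbreviation Neg :: "fm \<Rightarrow> fm" where "Neg \<phi> \<equiv> Imp \<phi> Falsum"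
abbreviation Or :: "fm \<Rightarrow> fm \<Rightarrow> fm" where "Or \<phi> \<psi> \<equiv> Imp (Neg \<phi>) \<psi>"
abbreviation And :: "fm \<Rightarrow> fm \<Rightarrow> fm" where "And \<phi> \<psi> \<equiv> Neg (Imp \<phi> (Neg \<psi>))"
abbreviation Iff :: "fm \<Rightarrow> fm \<Rightarrow> fm" where "Iff \<phi> \<psi> \<equiv> And (Imp \<phi> \<psi>) (Imp \<psi> \<phi>)"
abbreviation Exi :: "fm \<Rightarrow> fm" where "Exi \<phi> \<equiv> Neg (All (Neg \<phi>))"

definition conjs :: "fm list \<Rightarrow> fm" where "conjs \<phi>s = foldr And \<phi>s (Neg Falsum)"
definition disjs :: "fm list \<Rightarrow> fm" where "disjs \<phi>s = foldr Or \<phi>s Falsum"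

datatype sym = FunSym nat nat | RelSym nat nat

primrec syms_tm :: "tm \<Rightarrow> sym set" where
  "syms_tm (Var n) = {}"
| "syms_tm (Fun f ts) = insert (FunSym f (length ts)) (\<Union> (set (map syms_tm ts)))"

primrec syms :: "fm \<Rightarrow> sym set" where
  "syms Falsum = {}"
| "syms (Eq s t) = syms_tm s \<union> syms_tm t"
| "syms (Rel r ts) = insert (RelSym r (length ts)) (\<Union> (set (map syms_tm ts)))"
| "syms (Imp \<phi> \<psi>) = syms \<phi> \<union> syms \<psi>"
| "syms (All \<phi>) = syms \<phi>"

primrec free_tm :: "tm \<Rightarrow> nat set" where
  "free_tm (Var n) = {n}"
| "free_tm (Fun f ts) = \<Union> (set (map free_tm ts))"

primrec free :: "fm \<Rightarrow> nat set" where
  "free Falsum = {}"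
| "free (Eq s t) = free_tm s \<union> free_tm t"
| "free (Rel r ts) = \<Union> (set (map free_tm ts))"
| "free (Imp \<phi> \<psi>) = free \<phi> \<union> free \<psi>"
| "free (All \<phi>) = {n. Suc n \<in> free \<phi>}"

text \<open>Simultaneous capture-avoiding substitution.\<close>

primrec subst_tm :: "(nat \<Rightarrow> tm) \<Rightarrow> tm \<Rightarrow> tm" where
  "subst_tm \<sigma> (Var n) = \<sigma> n"
| "subst_tm \<sigma> (Fun f ts) = Fun f (map (subst_tm \<sigma>) ts)"

definition lift_subst :: "(nat \<Rightarrow> tm) \<Rightarrow> nat \<Rightarrow> tm" where
  "lift_subst \<sigma> = case_nat (Var 0) (\<lambda>n. subst_tm (\<lambda>m. Var (Suc m)) (\<sigma> n))"

primrec subst :: "(nat \<Rightarrow> tm) \<Rightarrow> fm \<Rightarrow> fm" where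
  "subst \<sigma> Falsum = Falsum"
| "subst \<sigma> (Eq s t) = Eq (subst_tm \<sigma> s) (subst_tm \<sigma> t)"
| "subst \<sigma> (Rel r ts) = Rel r (map (subst_tm \<sigma>) ts)"
| "subst \<sigma> (Imp \<phi> \<psi>) = Imp (subst \<sigma> \<phi>) (subst \<sigma> \<psi>)"
| "subst \<sigma> (All \<phi>) = All (subst (lift_subst \<sigma>) \<phi>)"

definition inst :: "fm \<Rightarrow> tm \<Rightarrow> fm" where
  "inst \<phi> t = subst (case_nat t Var) \<phi>"

definition shift :: "fm \<Rightarrow> fm" where
  "shift \<phi> = subst (\<lambda>n. Var (Suc n)) \<phi>"

text \<open>A Hilbert calculus. The rule \<open>Gen\<close> is unrestricted because it is only used with sets \<open>\<Gamma>\<close> of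
  sentences.\<close>

inductive proves :: "fm set \<Rightarrow> fm \<Rightarrow> bool" (infix "\<turnstile>" 50) for \<Gamma> :: "fm set" where
  Ax: "\<phi> \<in> \<Gamma> \<Longrightarrow> \<Gamma> \<turnstile> \<phi>"
| K: "\<Gamma> \<turnstile> Imp \<phi> (Imp \<psi> \<phi>)"
| S: "\<Gamma> \<turnstile> Imp (Imp \<phi> (Imp \<psi> \<chi>)) (Imp (Imp \<phi> \<psi>) (Imp \<phi> \<chi>))"
| DN: "\<Gamma> \<turnstile> Imp (Neg (Neg \<phi>)) \<phi>"
| All_inst: "\<Gamma> \<turnstile> Imp (All \<phi>) (inst \<phi> t)"
| All_dist: "\<Gamma> \<turnstile> Imp (All (Imp \<phi> \<psi>)) (Imp (All \<phi>) (All \<psi>))"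
| All_vac: "\<Gamma> \<turnstile> Imp \<phi> (All (shift \<phi>))"
| Eq_refl: "\<Gamma> \<turnstile> Eq t t"
| Eq_subst: "\<Gamma> \<turnstile> Imp (Eq s t) (Imp (inst \<phi> s) (inst \<phi> t))"
| MP: "\<Gamma> \<turnstile> Imp \<phi> \<psi> \<Longrightarrow> \<Gamma> \<turnstile> \<phi> \<Longrightarrow> \<Gamma> \<turnstile> \<psi>"
| Gen: "\<Gamma> \<turnstile> \<phi> \<Longrightarrow> \<Gamma> \<turnstile> All \<phi>"

primrec tm_code :: "tm \<Rightarrow> nat" where
  "tm_code (Var n) = prod_encode (0, n)"
| "tm_code (Fun f ts) = prod_encode (1, prod_encode (f, list_encode (map tm_code ts)))"

primrec fm_code :: "fm \<Rightarrow> nat" where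
  "fm_code Falsum = prod_encode (0, 0)"
| "fm_code (Eq s t) = prod_encode (1, prod_encode (tm_code s, tm_code t))"
| "fm_code (Rel r ts) = prod_encode (2, prod_encode (r, list_encode (map tm_code ts)))"
| "fm_code (Imp \<phi> \<psi>) = prod_encode (3, prod_encode (fm_code \<phi>, fm_code \<psi>))"
| "fm_code (All \<phi>) = prod_encode (4, fm_code \<phi>)"

primrec sym_code :: "sym \<Rightarrow> nat" where
  "sym_code (FunSym f k) = prod_encode (0, prod_encode (f, k))"
| "sym_code (RelSym r k) = prod_encode (1, prod_encode (r, k))"


section \<open>Theories\<close>

record fo_theory =
  lang :: "sym set"
  axioms :: "fm set"

definition sentence_of :: "sym set \<Rightarrow> fm \<Rightarrow> bool" where
  "sentence_of L \<phi> \<longleftrightarrow> free \<phi> = {} \<and> syms \<phi> \<subseteq> L"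

definition is_theory :: "fo_theory \<Rightarrow> bool" where
  "is_theory T \<longleftrightarrow> (\<forall>\<phi>\<in>axioms T. sentence_of (lang T) \<phi>)"

definition theorems :: "fo_theory \<Rightarrow> fm set" where
  "theorems T = {\<phi>. sentence_of (lang T) \<phi> \<and> axioms T \<turnstile> \<phi>}"

definition provable_set :: "fo_theory \<Rightarrow> nat set" where
  "provable_set T = fm_code ` {\<phi>. sentence_of (lang T) \<phi> \<and> axioms T \<turnstile> \<phi>}"

definition refutable_set :: "fo_theory \<Rightarrow> nat set" where
  "refutable_set T = fm_code ` {\<phi>. sentence_of (lang T) \<phi> \<and> axioms T \<turnstile> Neg \<phi>}"

definition consistent :: "fo_theory \<Rightarrow> bool" where
  "consistent T \<longleftrightarrow> \<not> axioms T \<turnstile> Falsum"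

definition RE_theory :: "fo_theory \<Rightarrow> bool" where
  "RE_theory T \<longleftrightarrow>
     is_theory T \<and> recursive_set (sym_code ` lang T) \<and> RE_set (provable_set T)"

text \<open>An index of an RE theory: a decision procedure for its language together with an
  enumeration procedure for its theorems.\<close>

definition theory_index :: "nat \<Rightarrow> fo_theory \<Rightarrow> bool" where
  "theory_index n T \<longleftrightarrow> is_theory T \<and>
     (\<exists>i j. n = prod_encode (i, j) \<and> decision_index i (sym_code ` lang T) \<and> W j = provable_set T)"

text \<open>Extensions may enlarge the language.\<close>

definition extends :: "fo_theory \<Rightarrow> fo_theory \<Rightarrow> bool" where
  "extends S T \<longleftrightarrow> lang T \<subseteq> lang S \<and> theorems T \<subseteq> theorems S"

definition undecidable :: "fo_theory \<Rightarrow> bool" where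
  "undecidable T \<longleftrightarrow> \<not> recursive_set (provable_set T)"

definition RI :: "fo_theory \<Rightarrow> bool" where
  "RI T \<longleftrightarrow>
     \<not> (\<exists>X. recursive_set X \<and> provable_set T \<subseteq> X \<and> X \<inter> refutable_set T = {})"

definition TP :: "fo_theory \<Rightarrow> bool" where
  "TP T \<longleftrightarrow> undecidable T \<and>
     (\<forall>S. RE_theory S \<and> consistent S \<and> extends S T \<longrightarrow> provable_set T \<le>\<^sub>T provable_set S)"

definition theory_degree :: "fo_theory \<Rightarrow> nat set set" where
  "theory_degree T = turing_degree (provable_set T)"


section \<open>Relative interpretations\<close>

text \<open>A (one-dimensional, parameter-free) translation gives a domain formula in variable 0, a
  formula for equality in variables 0, 1, for each \<open>k\<close>-ary relation symbol a formula in variables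
  \<open>0, \<dots>, k - 1\<close>, and for each \<open>k\<close>-ary function symbol a formula in variables \<open>0, \<dots>, k\<close>, variable \<open>k\<close>
  standing for the value.\<close>

record translation =
  dom_fm :: fm
  eq_fm :: fm
  rel_fm :: "nat \<Rightarrow> nat \<Rightarrow> fm"
  fun_fm :: "nat \<Rightarrow> nat \<Rightarrow> fm"

definition fm_over :: "sym set \<Rightarrow> nat \<Rightarrow> fm \<Rightarrow> bool" where
  "fm_over L k \<phi> \<longleftrightarrow> syms \<phi> \<subseteq> L \<and> free \<phi> \<subseteq> {..<k}"

definition is_translation :: "translation \<Rightarrow> sym set \<Rightarrow> sym set \<Rightarrow> bool" where
  "is_translation I L L' \<longleftrightarrow>
     fm_over L' 1 (dom_fm I) \<and> fm_over L' 2 (eq_fm I) \<and>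
     (\<forall>r k. RelSym r k \<in> L \<longrightarrow> fm_over L' k (rel_fm I r k)) \<and>
     (\<forall>f k. FunSym f k \<in> L \<longrightarrow> fm_over L' (Suc k) (fun_fm I f k))"

text \<open>\<open>with_values I vs \<chi>\<close> is the formula
  \<open>\<exists>u\<^sub>0 \<dots> u\<^sub>k\<^sub>-\<^sub>1. (\<delta>(u\<^sub>0) \<and> \<dots>) \<and> (vs\<^sub>0 has value u\<^sub>0 \<and> \<dots>) \<and> \<chi>\<close>, with \<open>u\<^sub>i\<close> the variable \<open>i\<close> inside the
  quantifier prefix.\<close>

definition with_values :: "translation \<Rightarrow> (nat \<Rightarrow> fm) list \<Rightarrow> fm \<Rightarrow> fm" where
  "with_values I vs \<chi> =
     (Exi ^^ length vs) (conjs
       (map (\<lambda>i. subst (\<lambda>_. Var i) (dom_fm I)) [0..<length vs]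
        @ map2 (\<lambda>v i. v i) vs [0..<length vs]
        @ [\<chi>]))"

text \<open>\<open>val_fm I t \<rho> y\<close> says that the value of \<open>t\<close>, with its variables renamed by \<open>\<rho>\<close>, is variable
  \<open>y\<close>; it unnests the function symbols of \<open>t\<close>.\<close>

primrec val_fm :: "translation \<Rightarrow> tm \<Rightarrow> (nat \<Rightarrow> nat) \<Rightarrow> nat \<Rightarrow> fm" where
  "val_fm I (Var n) = (\<lambda>\<rho> y. Eq (Var (\<rho> n)) (Var y))"
| "val_fm I (Fun f ts) = (\<lambda>\<rho> y.
     let k = length ts in
     with_values I (map (\<lambda>v. v (\<lambda>n. \<rho> n + k)) (map (val_fm I) ts))
       (subst (\<lambda>i. if i < k then Var i else Var (y + k)) (fun_fm I f k)))"

primrec translate :: "translation \<Rightarrow> fm \<Rightarrow> fm" where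
  "translate I Falsum = Falsum"
| "translate I (Eq s t) =
     with_values I (map (\<lambda>u. val_fm I u (\<lambda>n. n + 2)) [s, t]) (eq_fm I)"
| "translate I (Rel r ts) =
     with_values I (map (\<lambda>u. val_fm I u (\<lambda>n. n + length ts)) ts) (rel_fm I r (length ts))"
| "translate I (Imp \<phi> \<psi>) = Imp (translate I \<phi>) (translate I \<psi>)"
| "translate I (All \<phi>) = All (Imp (dom_fm I) (translate I \<phi>))"

text \<open>All theorems of \<open>T\<close> have to be translated to theorems of \<open>S\<close>. Among these are the equality
  axioms, \<open>\<exists>x. x = x\<close> and \<open>\<forall>x\<^sub>1 \<dots> x\<^sub>k \<exists>y. f(x\<^sub>1, \<dots>, x\<^sub>k) = y\<close>, so that the domain is nonempty and the
  formulas for function symbols define total functions on it (modulo the interpreted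
  equality).\<close>

definition interprets :: "fo_theory \<Rightarrow> fo_theory \<Rightarrow> bool" where
  "interprets S T \<longleftrightarrow>
     (\<exists>I. is_translation I (lang T) (lang S) \<and> (\<forall>\<phi>\<in>theorems T. axioms S \<turnstile> translate I \<phi>))"


section \<open>The theory R\<close>

abbreviation Zero :: tm where "Zero \<equiv> Fun 0 []"
abbreviation Succ :: "tm \<Rightarrow> tm" where "Succ t \<equiv> Fun 1 [t]"
abbreviation Plus :: "tm \<Rightarrow> tm \<Rightarrow> tm" where "Plus s t \<equiv> Fun 2 [s, t]"
abbreviation Times :: "tm \<Rightarrow> tm \<Rightarrow> tm" where "Times s t \<equiv> Fun 3 [s, t]"
abbreviation Le :: "tm \<Rightarrow> tm \<Rightarrow> fm" where "Le s t \<equiv> Rel 0 [s, t]"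

definition num :: "nat \<Rightarrow> tm" where
  "num n = (Succ ^^ n) Zero"

text \<open>The first axiom is the definition \<open>\<forall>x y. x \<le> y \<longleftrightarrow> (\<exists>z. z + x = y)\<close> of the symbol \<open>\<le>\<close>.\<close>

definition theory_R :: fo_theory where
  "theory_R = \<lparr>
     lang = {FunSym 0 0, FunSym 1 1, FunSym 2 2, FunSym 3 2, RelSym 0 2},
     axioms =
       {All (All (Iff (Le (Var 1) (Var 0)) (Exi (Eq (Plus (Var 0) (Var 2)) (Var 1)))))}
       \<union> {Eq (Plus (num m) (num n)) (num (m + n)) | m n. True}
       \<union> {Eq (Times (num m) (num n)) (num (m * n)) | m n. True}
       \<union> {Neg (Eq (num m) (num n)) | m n. m \<noteq> n}
       \<union> {All (Imp (Le (Var 0) (num n)) (disjs (map (\<lambda>i. Eq (Var 0) (num i)) [0..<Suc n]))) | n. True}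
       \<union> {All (Or (Le (Var 0) (num n)) (Le (num n) (Var 0))) | n. True}\<rparr>"

end

(* Fix e. When n enters W e, each pair (j, n) is put into one of two disjoint RE sets: into the
   second one if it has already entered W j, into the first one otherwise. An RE set W j that
   separates them has to contain (j, n), but cannot do so before n enters W e; hence to decide n,
   ask the separator about (j, n) and, if the answer is yes, run W e until (j, n) shows up in W j.
   So every RE separator computes W e.

   T has one propositional letter per pair, and consists of the sentences that hold in every
   one-element structure in which the letters of the first set are true and those of the second
   set are false. A consistent RE extension, or a recursive set between the provable and the
   refutable sentences, yields a separator, which gives TP and RI. Conversely, W e tells from which
   stage on the letters in a given sentence no longer change their status, so T is computable from
   W e. In a one-element structure an interpretation cannot make 0 and 1 different, so T does not
   interpret R. *)
theory Submission
  imports Defs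
begin

text \<open>The obstacle is a tension: coding \<open>W e\<close> into every separator makes the two
  sets hard, while they must stay below \<open>W e\<close>. Both demands are met because a pair is
  placed only at the moment when its second component enters \<open>W e\<close>, and never moved
  afterwards. The index \<open>j\<close> inside the pair gives each RE set a witness of its own for
  each \<open>n\<close>, so one construction acts against all RE sets at once. That the separator is
  RE matters, not only that an oracle decides it: its index supplies the time at which the pair
  appears, and this time bounds the search for \<open>n\<close>.

  Stages are codes of derivations of the oracle-free computation relation, compared as numbers.
  Taking all valid sentences as axioms makes provability coincide with validity by soundness alone,
  and validity is a finite check of valuations. The construction is uniform in \<open>e\<close> and
  makes sense for every \<open>e\<close>; that \<open>W e\<close> is not recursive enters only for
  inseparability and undecidability.\<close>

section \<open>Computable functions on tuples\<close>

inductive_cases computes_PZeroE: "computes X PZero xs y"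
inductive_cases computes_PSuccE: "computes X PSucc xs y"
inductive_cases computes_PProjE: "computes X (PProj i) xs y"
inductive_cases computes_POracleE: "computes X POracle xs y"
inductive_cases computes_PCompE: "computes X (PComp f gs) xs y"
inductive_cases computes_PPrecE: "computes X (PPrec f g) xs y"
inductive_cases computes_PMuE: "computes X (PMu f) xs y"

lemma computes_deterministic:
  "computes X p xs y \<Longrightarrow> computes X p xs z \<Longrightarrow> y = z"
proof (induction arbitrary: z rule: computes.induct)
  case (comp xs gs ys f z')
  from comp.prems obtain ys' where ys': "list_all2 (\<lambda>g y. computes X g xs y) gs ys'"
    and z: "computes X f ys' z" by (rule computes_PCompE)
  have "ys = ys'"
    using comp.IH(1) ys' by (auto simp: list_all2_conv_all_nth intro!: nth_equalityI)
  with comp.IH z show ?case by auto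
next
  case (prec_0 f xs y g)
  from prec_0.prems show ?case by (rule computes_PPrecE) (use prec_0.IH in auto)
next
  case (prec_Suc f g n xs r y)
  from prec_Suc.prems show ?case by (rule computes_PPrecE) (use prec_Suc.IH in auto)
next
  case (mu f n xs)
  from mu.prems have z: "computes X f (z # xs) 0" "\<forall>m<z. \<exists>k. computes X f (m # xs) (Suc k)"
    by (auto elim: computes_PMuE)
  have "\<not> z < n" using mu.IH(2) z(1) by fastforce
  moreover have "\<not> n < z" using mu.IH(1) z(2) by fastforce
  ultimately show ?case by simp
qed (auto elim: computes_PZeroE computes_PSuccE computes_PProjE computes_POracleE)

text \<open>Behaviour on other lengths is left open, since ill-formed calls diverge.\<close>

definition tuple_computable :: "nat set \<Rightarrow> nat \<Rightarrow> (nat list \<Rightarrow> nat) \<Rightarrow> bool" where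
  "tuple_computable X k F \<longleftrightarrow> (\<exists>p. \<forall>xs. length xs = k \<longrightarrow> computes X p xs (F xs))"

lemma tuple_computable_nth: "i < k \<Longrightarrow> tuple_computable X k (\<lambda>xs. xs ! i)"
  unfolding tuple_computable_def by (auto intro!: exI[of _ "PProj i"] computes.proj)

lemma tuple_computable_comp:
  assumes F: "tuple_computable X (length Gs) F"
    and Gs: "\<And>G. G \<in> set Gs \<Longrightarrow> tuple_computable X k G"
  shows "tuple_computable X k (\<lambda>xs. F (map (\<lambda>G. G xs) Gs))"
proof -
  obtain p where p: "\<And>xs. length xs = length Gs \<Longrightarrow> computes X p xs (F xs)"
    using F by (auto simp: tuple_computable_def)
  obtain q where q: "\<And>G xs. G \<in> set Gs \<Longrightarrow> length xs = k \<Longrightarrow> computes X (q G) xs (G xs)"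
    using Gs unfolding tuple_computable_def by metis
  have "computes X (PComp p (map q Gs)) xs (F (map (\<lambda>G. G xs) Gs))" if "length xs = k" for xs
    by (rule computes.comp[where ys = "map (\<lambda>G. G xs) Gs"])
      (auto simp: list_all2_conv_all_nth q that intro: p)
  then show ?thesis by (auto simp: tuple_computable_def)
qed

lemma tuple_computable_comp1:
  assumes "tuple_computable X 1 (\<lambda>xs. f (xs ! 0))" "tuple_computable X k F"
  shows "tuple_computable X k (\<lambda>xs. f (F xs))"
  using tuple_computable_comp[of X "[F]" "\<lambda>xs. f (xs ! 0)" k] assms by simp

lemma tuple_computable_Suc:
  assumes "tuple_computable X k F"
  shows "tuple_computable X k (\<lambda>xs. Suc (F xs))"
proof (rule tuple_computable_comp1[OF _ assms])
  have "computes X PSucc xs (Suc (xs ! 0))" if "length xs = 1" for xs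
    using that computes.succ[of X "xs ! 0"] by (cases xs) auto
  then show "tuple_computable X 1 (\<lambda>xs. Suc (xs ! 0))" by (auto simp: tuple_computable_def)
qed

lemma tuple_computable_oracle:
  assumes "tuple_computable X k F"
  shows "tuple_computable X k (\<lambda>xs. of_bool (F xs \<in> X))"
proof (rule tuple_computable_comp1[OF _ assms])
  have "computes X POracle xs (of_bool (xs ! 0 \<in> X))" if "length xs = 1" for xs
    using that computes.orac[of X "xs ! 0"] by (cases xs) (auto simp: of_bool_def)
  then show "tuple_computable X 1 (\<lambda>xs. of_bool (xs ! 0 \<in> X))"
    unfolding tuple_computable_def by blast
qed

lemma tuple_computable_const: "tuple_computable X k (\<lambda>_. n)"
proof (induction n)
  case 0
  show ?case unfolding tuple_computable_def by (auto intro!: exI[of _ PZero] computes.zero)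
next
  case (Suc n)
  then show ?case by (rule tuple_computable_Suc)
qed

lemma tuple_computable_rec:
  assumes F: "tuple_computable X k F" and H: "tuple_computable X k H"
    and G: "tuple_computable X (Suc (Suc k)) G"
  shows "tuple_computable X k (\<lambda>xs. rec_nat (F xs) (\<lambda>n r. G (n # r # xs)) (H xs))"
proof -
  obtain f g where f: "\<And>xs. length xs = k \<Longrightarrow> computes X f xs (F xs)"
    and g: "\<And>xs. length xs = Suc (Suc k) \<Longrightarrow> computes X g xs (G xs)"
    using F G unfolding tuple_computable_def by metis
  have *: "computes X (PPrec f g) (m # xs) (rec_nat (F xs) (\<lambda>n r. G (n # r # xs)) m)"
    if "length xs = k" for xs m
    using that by (induction m) (auto intro!: f g computes.prec_0 intro: computes.prec_Suc)
  have "computes X (PPrec f g) xs (rec_nat (F (tl xs)) (\<lambda>n r. G (n # r # tl xs)) (hd xs))"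
    if "length xs = Suc k" for xs
    using *[of "tl xs" "hd xs"] that by (cases xs) auto
  then have "tuple_computable X (Suc k)
      (\<lambda>xs. rec_nat (F (tl xs)) (\<lambda>n r. G (n # r # tl xs)) (hd xs))"
    by (auto simp: tuple_computable_def)
  \<comment> \<open>The recursion counter is the value of \<open>H\<close>, while the parameters are
    passed on unchanged through the \<open>k\<close> projections.\<close>
  then have "tuple_computable X k (\<lambda>xs. (\<lambda>xs. rec_nat (F (tl xs)) (\<lambda>n r. G (n # r # tl xs)) (hd xs))
      (map (\<lambda>G. G xs) (H # map (\<lambda>i xs. xs ! i) [0..<k])))"
    by (intro tuple_computable_comp) (auto intro: H tuple_computable_nth)
  moreover have "map (\<lambda>G. G xs) (map (\<lambda>i xs. xs ! i) [0..<k]) = xs" if "length xs = k"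
    for xs :: "nat list"
    using that by (auto intro: nth_equalityI)
  ultimately show ?thesis unfolding tuple_computable_def by (auto simp: comp_def)
qed

text \<open>Minimization requires defined positive values at all smaller arguments; \<open>G\<close>
  is total, so the existence of a zero is the only proviso.\<close>

lemma tuple_computable_Least:
  assumes G: "tuple_computable X (Suc k) G"
    and ex: "\<And>xs. length xs = k \<Longrightarrow> \<exists>n. G (n # xs) = 0"
  shows "tuple_computable X k (\<lambda>xs. LEAST n. G (n # xs) = 0)"
proof -
  obtain g where g: "\<And>xs. length xs = Suc k \<Longrightarrow> computes X g xs (G xs)"
    using G unfolding tuple_computable_def by metis
  have "computes X (PMu g) xs (LEAST n. G (n # xs) = 0)" if xs: "length xs = k" for xs
  proof (rule computes.mu)
    have "G ((LEAST n. G (n # xs) = 0) # xs) = 0"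
      using ex[OF xs] by (rule LeastI_ex)
    then show "computes X g ((LEAST n. G (n # xs) = 0) # xs) 0"
      using g[of "(LEAST n. G (n # xs) = 0) # xs"] xs by simp
    show "\<forall>m<(LEAST n. G (n # xs) = 0). \<exists>k. computes X g (m # xs) (Suc k)"
    proof (intro allI impI)
      fix m assume "m < (LEAST n. G (n # xs) = 0)"
      then have "G (m # xs) \<noteq> 0" by (auto dest: not_less_Least)
      then show "\<exists>k. computes X g (m # xs) (Suc k)"
        using g[of "m # xs"] xs by (metis length_Cons not0_implies_Suc)
    qed
  qed
  then show ?thesis by (auto simp: tuple_computable_def)
qed

lemma tuple_computable_add:
  assumes "tuple_computable X k F" "tuple_computable X k G"
  shows "tuple_computable X k (\<lambda>xs. F xs + G xs)"
proof -
  have "tuple_computable X k (\<lambda>xs. rec_nat (F xs) (\<lambda>n r. (\<lambda>ys. Suc (ys ! 1)) (n # r # xs)) (G xs))"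
    by (intro tuple_computable_rec tuple_computable_Suc tuple_computable_nth assms) auto
  moreover have "rec_nat a (\<lambda>n r. Suc r) b = a + b" for a b by (induction b) auto
  ultimately show ?thesis by simp
qed

lemma tuple_computable_diff:
  assumes "tuple_computable X k F" "tuple_computable X k G"
  shows "tuple_computable X k (\<lambda>xs. F xs - G xs)"
proof -
  have pred: "tuple_computable X k (\<lambda>xs. H xs - 1)" if "tuple_computable X k H" for k H
  proof -
    have "tuple_computable X k (\<lambda>xs. rec_nat 0 (\<lambda>n r. (\<lambda>ys. ys ! 0) (n # r # xs)) (H xs))"
      by (intro tuple_computable_rec tuple_computable_const tuple_computable_nth that) auto
    moreover have "rec_nat 0 (\<lambda>n r. n) b = b - 1" for b by (cases b) auto
    ultimately show ?thesis by simp
  qed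
  have "tuple_computable X k (\<lambda>xs. rec_nat (F xs) (\<lambda>n r. (\<lambda>ys. ys ! 1 - 1) (n # r # xs)) (G xs))"
    by (intro tuple_computable_rec pred tuple_computable_nth assms) auto
  moreover have "rec_nat a (\<lambda>n r. r - Suc 0) b = a - b" for a b by (induction b) auto
  ultimately show ?thesis by simp
qed

lemma tuple_computable_triangle:
  assumes "tuple_computable X k F"
  shows "tuple_computable X k (\<lambda>xs. triangle (F xs))"
proof -
  have "tuple_computable X k
      (\<lambda>xs. rec_nat 0 (\<lambda>n r. (\<lambda>ys. ys ! 1 + Suc (ys ! 0)) (n # r # xs)) (F xs))"
    by (intro tuple_computable_rec tuple_computable_const tuple_computable_add tuple_computable_Suc
        tuple_computable_nth assms) auto
  moreover have "rec_nat 0 (\<lambda>n r. r + Suc n) b = triangle b" for b by (induction b) auto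
  ultimately show ?thesis by simp
qed

section \<open>Cantor pairing and its inverse\<close>

lemma tuple_computable_prod_encode:
  assumes "tuple_computable X k F" "tuple_computable X k G"
  shows "tuple_computable X k (\<lambda>xs. prod_encode (F xs, G xs))"
  unfolding prod_encode_def by (simp, intro tuple_computable_add tuple_computable_triangle assms)

text \<open>The index \<open>a + b\<close> of the antidiagonal containing the pair
  \<open>(a, b)\<close> coded by \<open>n\<close>. It reduces \<open>prod_decode\<close> to one
  minimization and truncated subtractions.\<close>

definition diagonal :: "nat \<Rightarrow> nat" where
  "diagonal n = (LEAST d. n < triangle (Suc d))"

lemma diagonal: "triangle (diagonal n) \<le> n" "n < triangle (Suc (diagonal n))"
proof -
  have "m < triangle (Suc m)" for m by (induction m) auto
  then show "n < triangle (Suc (diagonal n))" unfolding diagonal_def by (rule LeastI)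
  show "triangle (diagonal n) \<le> n"
  proof (cases "diagonal n")
    case (Suc d)
    then have "\<not> n < triangle (Suc d)"
      unfolding diagonal_def by (intro not_less_Least) simp
    with Suc show ?thesis by simp
  qed simp
qed

lemma prod_decode_diagonal:
  "prod_decode n = (n - triangle (diagonal n), diagonal n - (n - triangle (diagonal n)))"
proof -
  have "prod_encode (n - triangle (diagonal n), diagonal n - (n - triangle (diagonal n))) = n"
    using diagonal[of n] by (simp add: prod_encode_def)
  then show ?thesis by (metis prod_encode_inverse)
qed

lemma tuple_computable_diagonal:
  assumes "tuple_computable X k F"
  shows "tuple_computable X k (\<lambda>xs. diagonal (F xs))"
proof (rule tuple_computable_comp1[OF _ assms])
  have "tuple_computable X 1
      (\<lambda>xs. LEAST d. (\<lambda>ys. Suc (ys ! 1) - triangle (Suc (ys ! 0))) (d # xs) = 0)"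
  proof (rule tuple_computable_Least)
    show "\<exists>n. (\<lambda>ys. Suc (ys ! 1) - triangle (Suc (ys ! 0))) (n # xs) = 0" for xs
      using diagonal(2)[of "xs ! 0"] by (auto simp: Suc_le_eq simp del: triangle_Suc)
  qed (intro tuple_computable_diff tuple_computable_triangle tuple_computable_Suc
        tuple_computable_nth; simp)
  then show "tuple_computable X 1 (\<lambda>xs. diagonal (xs ! 0))"
    unfolding diagonal_def by (simp add: Suc_le_eq del: triangle_Suc)
qed

lemma tuple_computable_prod_decode:
  assumes "tuple_computable X k F"
  shows "tuple_computable X k (\<lambda>xs. fst (prod_decode (F xs)))"
    and "tuple_computable X k (\<lambda>xs. snd (prod_decode (F xs)))"
  unfolding prod_decode_diagonal fst_conv snd_conv
  by (intro tuple_computable_diff tuple_computable_triangle tuple_computable_diagonal assms)+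

section \<open>Computable functions on encodable types\<close>

text \<open>A bijection and not just an injection: every number decodes to an element, so a search
  over numbers is a search over pairs, lists or derivations, with no validity test.\<close>

class enc =
  fixes enc :: "'a \<Rightarrow> nat" and dec :: "nat \<Rightarrow> 'a"
  assumes dec_enc [simp]: "dec (enc x) = x" and enc_dec [simp]: "enc (dec n) = n"

lemma enc_eq_iff [simp]: "enc x = enc y \<longleftrightarrow> x = y"
  by (metis dec_enc)

instantiation nat :: enc
begin
definition enc_nat :: "nat \<Rightarrow> nat" where [simp]: "enc_nat n = n"
definition dec_nat :: "nat \<Rightarrow> nat" where [simp]: "dec_nat n = n"
instance by standard auto
end

instantiation prod :: (enc, enc) enc
begin
definition enc_prod :: "'a \<times> 'b \<Rightarrow> nat" where "enc_prod x = prod_encode (enc (fst x), enc (snd x))"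
definition dec_prod :: "nat \<Rightarrow> 'a \<times> 'b"
  where "dec_prod n = (dec (fst (prod_decode n)), dec (snd (prod_decode n)))"
instance by standard (auto simp: enc_prod_def dec_prod_def)
end

instantiation list :: (enc) enc
begin
definition enc_list :: "'a list \<Rightarrow> nat" where "enc_list xs = list_encode (map enc xs)"
definition dec_list :: "nat \<Rightarrow> 'a list" where "dec_list n = map dec (list_decode n)"
instance by standard (auto simp: enc_list_def dec_list_def comp_def)
end

lemma enc_nat_list: "enc xs = list_encode xs" for xs :: "nat list"
  by (simp add: enc_list_def map_idI)

lemma enc_nat_pair: "enc (a, b) = prod_encode (a, b)" for a b :: nat
  by (simp add: enc_prod_def)

definition computable :: "nat set \<Rightarrow> ('a::enc \<Rightarrow> 'b::enc) \<Rightarrow> bool" where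
  "computable X f \<longleftrightarrow> tuple_computable X 1 (\<lambda>xs. enc (f (dec (xs ! 0))))"

definition decidable :: "nat set \<Rightarrow> ('a::enc \<Rightarrow> bool) \<Rightarrow> bool" where
  "decidable X P \<longleftrightarrow> computable X (\<lambda>x. of_bool (P x) :: nat)"

lemma computable_iff_computes:
  "computable X f \<longleftrightarrow> (\<exists>p. \<forall>x. computes X p [enc x] (enc (f x)))"
proof -
  have "(\<forall>xs. length xs = 1 \<longrightarrow> computes X p xs (enc (f (dec (xs ! 0))))) \<longleftrightarrow>
      (\<forall>x. computes X p [enc x] (enc (f x)))" (is "?L \<longleftrightarrow> ?R") for p
  proof
    show "?L \<Longrightarrow> ?R" by (metis One_nat_def dec_enc length_Cons list.size(3) nth_Cons_0)
    assume R: ?R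
    show ?L
    proof (intro allI impI)
      fix xs :: "nat list" assume "length xs = 1"
      then have "xs = [enc (dec (xs ! 0) :: 'a)]" by (cases xs) auto
      then show "computes X p xs (enc (f (dec (xs ! 0))))" using R by metis
    qed
  qed
  then show ?thesis unfolding computable_def tuple_computable_def by simp
qed

lemma recursive_fun_iff: "recursive_fun f \<longleftrightarrow> computable {} f"
  by (simp add: recursive_fun_def computable_iff_computes)

lemma computes_char_iff: "(\<exists>p. computes_char X p A) \<longleftrightarrow> decidable X (\<lambda>n. n \<in> A)"
  by (simp add: computes_char_def decidable_def computable_iff_computes of_bool_def)

lemma recursive_set_iff: "recursive_set A \<longleftrightarrow> decidable {} (\<lambda>n. n \<in> A)"
  by (simp add: recursive_set_def computes_char_iff)

lemma turing_le_iff: "A \<le>\<^sub>T B \<longleftrightarrow> decidable B (\<lambda>n. n \<in> A)"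
  by (simp add: turing_le_def computes_char_iff)

section \<open>Closure rules for computable expressions\<close>

named_theorems comp_intro

lemma tuple_computable_enc:
  assumes "computable X f" "tuple_computable X k (\<lambda>xs. enc (F xs))"
  shows "tuple_computable X k (\<lambda>xs. enc (f (F xs)))"
  using tuple_computable_comp1[OF assms(1)[unfolded computable_def] assms(2)] by simp

lemma computable_comp:
  assumes "computable X g" "computable X f"
  shows "computable X (\<lambda>x. g (f x))"
  using tuple_computable_enc[OF assms(1) assms(2)[unfolded computable_def]]
  by (simp add: computable_def)

lemma decidable_comp:
  "decidable X P \<Longrightarrow> computable X f \<Longrightarrow> decidable X (\<lambda>x. P (f x))"
  unfolding decidable_def by (rule computable_comp)

lemma computable_const [comp_intro]: "computable X (\<lambda>_. c)"
  unfolding computable_def by (rule tuple_computable_const)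

lemma computable_ident [comp_intro]: "computable X (\<lambda>x. x)"
  unfolding computable_def by (simp add: tuple_computable_nth)

lemma computable_enc [comp_intro]: "computable X f \<Longrightarrow> computable X (\<lambda>x. enc (f x))"
  unfolding computable_def by simp

lemma computable_dec [comp_intro]: "computable X f \<Longrightarrow> computable X (\<lambda>x. dec (f x))"
  unfolding computable_def by simp

lemma computable_Pair [comp_intro]:
  "computable X f \<Longrightarrow> computable X g \<Longrightarrow> computable X (\<lambda>x. (f x, g x))"
  unfolding computable_def enc_prod_def fst_conv snd_conv by (rule tuple_computable_prod_encode)

lemma computable_fst [comp_intro]:
  assumes "computable X f" shows "computable X (\<lambda>x. fst (f x))"
proof -
  have "prod_decode (enc y) = (enc (fst y), enc (snd y))" for y :: "'b \<times> 'c"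
    by (simp add: enc_prod_def)
  then show ?thesis
    using tuple_computable_prod_decode(1)[OF assms[unfolded computable_def]]
    by (simp add: computable_def)
qed

lemma computable_snd [comp_intro]:
  assumes "computable X f" shows "computable X (\<lambda>x. snd (f x))"
proof -
  have "prod_decode (enc y) = (enc (fst y), enc (snd y))" for y :: "'b \<times> 'c"
    by (simp add: enc_prod_def)
  then show ?thesis
    using tuple_computable_prod_decode(2)[OF assms[unfolded computable_def]]
    by (simp add: computable_def)
qed

lemma computable_prod_encode [comp_intro]:
  "computable X f \<Longrightarrow> computable X g \<Longrightarrow> computable X (\<lambda>x. prod_encode (f x, g x))"
  unfolding computable_def enc_nat_def by (rule tuple_computable_prod_encode)

lemma computable_prod_decode [comp_intro]:
  "computable X f \<Longrightarrow> computable X (\<lambda>x. prod_decode (f x))"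
  unfolding computable_def by (simp add: enc_prod_def)

lemma computable_list_decode [comp_intro]:
  "computable X f \<Longrightarrow> computable X (\<lambda>x. list_decode (f x))"
  unfolding computable_def by (simp add: enc_nat_list)

lemma computable_list_encode [comp_intro]:
  "computable X f \<Longrightarrow> computable X (\<lambda>x. list_encode (f x))"
  unfolding computable_def by (simp add: enc_nat_list)

lemma computable_comp2:
  "computable X (\<lambda>p. F (fst p) (snd p)) \<Longrightarrow> computable X f \<Longrightarrow> computable X g \<Longrightarrow>
    computable X (\<lambda>x. F (f x) (g x))"
  using computable_comp[of X "\<lambda>p. F (fst p) (snd p)" "\<lambda>x. (f x, g x)"] computable_Pair by auto

lemma decidable_comp2:
  "decidable X (\<lambda>p. P (fst p) (snd p)) \<Longrightarrow> computable X f \<Longrightarrow> computable X g \<Longrightarrow>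
    decidable X (\<lambda>x. P (f x) (g x))"
  unfolding decidable_def by (rule computable_comp2[where F = "\<lambda>x y. of_bool (P x y)"])

lemma computable_comp3:
  assumes "computable X (\<lambda>p. F (fst p) (fst (snd p)) (snd (snd p)))"
    and "computable X f" "computable X g" "computable X h"
  shows "computable X (\<lambda>x. F (f x) (g x) (h x))"
  using computable_comp[OF assms(1) computable_Pair[OF assms(2) computable_Pair[OF assms(3,4)]]]
  by simp

lemma decidable_comp3:
  "decidable X (\<lambda>p. P (fst p) (fst (snd p)) (snd (snd p))) \<Longrightarrow> computable X f \<Longrightarrow>
    computable X g \<Longrightarrow> computable X h \<Longrightarrow> decidable X (\<lambda>x. P (f x) (g x) (h x))"
  unfolding decidable_def by (rule computable_comp3[where F = "\<lambda>x y z. of_bool (P x y z)"])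

lemma computable_Suc [comp_intro]: "computable X f \<Longrightarrow> computable X (\<lambda>x. Suc (f x))"
  unfolding computable_def enc_nat_def by (rule tuple_computable_Suc)

lemma computable_add [comp_intro]:
  "computable X f \<Longrightarrow> computable X g \<Longrightarrow> computable X (\<lambda>x. f x + g x :: nat)"
  unfolding computable_def enc_nat_def by (rule tuple_computable_add)

lemma computable_diff [comp_intro]:
  "computable X f \<Longrightarrow> computable X g \<Longrightarrow> computable X (\<lambda>x. f x - g x :: nat)"
  unfolding computable_def enc_nat_def by (rule tuple_computable_diff)

lemma computable_rec_nat [comp_intro]:
  assumes f: "computable X f" and h: "computable X h"
    and g: "computable X (\<lambda>p. g (fst p) (fst (snd p)) (snd (snd p)))"
  shows "computable X (\<lambda>x. rec_nat (f x) (\<lambda>n r. g x n r) (h x))"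
proof -
  \<comment> \<open>The underlying recursion works on \<open>[n, r, x]\<close>: the counter as it
    is, the previous value and the parameter as codes.\<close>
  let ?G = "\<lambda>ys. enc (g (dec (ys ! 2)) (ys ! 0) (dec (ys ! 1)))"
  have "tuple_computable X 3 (\<lambda>ys. enc (dec (ys ! 2) :: 'a, ys ! 0, dec (ys ! 1) :: 'b))"
    unfolding enc_prod_def fst_conv snd_conv enc_dec enc_nat_def
    by (intro tuple_computable_prod_encode tuple_computable_nth) auto
  from tuple_computable_enc[OF g this] have "tuple_computable X 3 ?G" by simp
  then have "tuple_computable X 1 (\<lambda>xs. rec_nat (enc (f (dec (xs ! 0)))) (\<lambda>n r. ?G (n # r # xs))
      (enc (h (dec (xs ! 0)))))"
    by (intro tuple_computable_rec f[unfolded computable_def] h[unfolded computable_def])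
      (simp add: numeral_3_eq_3)
  moreover have "rec_nat (enc (f x)) (\<lambda>n r. enc (g x n (dec r))) m = enc (rec_nat (f x) (\<lambda>n r. g x n r) m)"
    for x m by (induction m) auto
  ultimately show ?thesis unfolding computable_def by simp
qed

lemma decidable_neq_0: "computable X f \<Longrightarrow> decidable X (\<lambda>x. f x \<noteq> (0::nat))"
proof -
  assume "computable X f"
  then have "computable X (\<lambda>x. 1 - (1 - f x))" by (intro comp_intro)
  moreover have "1 - (1 - n) = of_bool (n \<noteq> 0)" for n :: nat by (cases n) auto
  ultimately show ?thesis by (simp add: decidable_def)
qed

lemma computable_If [comp_intro]:
  assumes "decidable X P" "computable X f" "computable X g"
  shows "computable X (\<lambda>x. if P x then f x else g x)"
proof -
  \<comment> \<open>A recursion of length 0 or 1 acts as a conditional.\<close>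
  have "computable X (\<lambda>x. rec_nat (g x) (\<lambda>_ _. f x) (of_bool (P x)))"
    by (intro comp_intro assms computable_comp[OF assms(2)] assms(1)[unfolded decidable_def])
  moreover have "rec_nat a (\<lambda>_ _. b) (of_bool Q) = (if Q then b else a)" for a b :: 'b and Q by simp
  ultimately show ?thesis by simp
qed

lemma decidable_const [comp_intro]: "decidable X (\<lambda>_. P)"
  unfolding decidable_def by (intro comp_intro)

lemma decidable_not [comp_intro]: "decidable X P \<Longrightarrow> decidable X (\<lambda>x. \<not> P x)"
proof -
  assume "decidable X P"
  then have "computable X (\<lambda>x. if P x then 0 else 1 :: nat)" by (intro comp_intro)
  moreover have "(if Q then 0 else 1) = (of_bool (\<not> Q) :: nat)" for Q by simp
  ultimately show ?thesis by (simp only: decidable_def)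
qed

lemma decidable_If [comp_intro]:
  assumes "decidable X P" "decidable X Q" "decidable X R"
  shows "decidable X (\<lambda>x. if P x then Q x else R x)"
proof -
  have "computable X (\<lambda>x. if P x then of_bool (Q x) else of_bool (R x) :: nat)"
    using assms(2,3) unfolding decidable_def by (intro computable_If assms(1))
  moreover have "(if A then of_bool B else of_bool C) = (of_bool (if A then B else C) :: nat)"
    for A B C by simp
  ultimately show ?thesis by (simp only: decidable_def)
qed

lemma decidable_conj [comp_intro]:
  assumes "decidable X P" "decidable X Q" shows "decidable X (\<lambda>x. P x \<and> Q x)"
proof -
  have "(if A then B else False) \<longleftrightarrow> A \<and> B" for A B by simp
  with decidable_If[OF assms decidable_const[of X False]] show ?thesis by (simp only:)
qed

lemma decidable_disj [comp_intro]:
  assumes "decidable X P" "decidable X Q" shows "decidable X (\<lambda>x. P x \<or> Q x)"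
proof -
  have "(if A then True else B) \<longleftrightarrow> A \<or> B" for A B by simp
  with decidable_If[OF assms(1) decidable_const[of X True] assms(2)] show ?thesis by (simp only:)
qed

lemma decidable_imp [comp_intro]:
  assumes "decidable X P" "decidable X Q" shows "decidable X (\<lambda>x. P x \<longrightarrow> Q x)"
proof -
  have "(if A then B else True) \<longleftrightarrow> (A \<longrightarrow> B)" for A B by simp
  with decidable_If[OF assms decidable_const[of X True]] show ?thesis by (simp only:)
qed

lemma decidable_le [comp_intro]:
  assumes "computable X f" "computable X g" shows "decidable X (\<lambda>x. f x \<le> (g x :: nat))"
proof -
  have "decidable X (\<lambda>x. \<not> (f x - g x \<noteq> 0))"
    by (intro decidable_not decidable_neq_0 comp_intro assms)
  then show ?thesis by simp
qed

lemma decidable_less [comp_intro]: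
  assumes "computable X f" "computable X g" shows "decidable X (\<lambda>x. f x < (g x :: nat))"
proof -
  have "decidable X (\<lambda>x. Suc (f x) \<le> g x)" by (intro comp_intro assms)
  then show ?thesis by (simp add: Suc_le_eq)
qed

lemma decidable_eq [comp_intro]:
  assumes "computable X f" "computable X g" shows "decidable X (\<lambda>x. f x = g x)"
proof -
  have "decidable X (\<lambda>x. enc (f x) \<le> enc (g x) \<and> enc (g x) \<le> enc (f x))"
    by (intro comp_intro assms)
  then show ?thesis by (simp add: eq_iff[symmetric])
qed

lemma decidable_oracle: "computable X f \<Longrightarrow> decidable X (\<lambda>x. f x \<in> X)"
  unfolding computable_def decidable_def enc_nat_def by (rule tuple_computable_oracle)

lemma computable_Least:
  fixes P :: "'a::enc \<Rightarrow> nat \<Rightarrow> bool"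
  assumes P: "decidable X (\<lambda>p. P (fst p) (snd p))" and ex: "\<And>x. \<exists>n. P x n"
  shows "computable X (\<lambda>x. LEAST n. P x n)"
proof -
  have neg: "computable X (\<lambda>p. of_bool (\<not> P (fst p) (snd p)) :: nat)"
    using decidable_not[OF P] by (simp add: decidable_def)
  have "tuple_computable X 2 (\<lambda>ys. enc (dec (ys ! 1) :: 'a, ys ! 0))"
    unfolding enc_prod_def fst_conv snd_conv enc_dec enc_nat_def
    by (intro tuple_computable_prod_encode tuple_computable_nth) auto
  from tuple_computable_enc[OF neg this]
  have "tuple_computable X (Suc 1) (\<lambda>ys. of_bool (\<not> P (dec (ys ! 1)) (ys ! 0)))"
    by (simp add: numeral_2_eq_2)
  from tuple_computable_Least[OF this] show ?thesis
    using ex by (simp add: computable_def)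
qed

lemma decidable_all_less [comp_intro]:
  fixes h :: "'a::enc \<Rightarrow> nat"
  assumes "decidable X (\<lambda>p. P (fst p) (snd p))" "computable X h"
  shows "decidable X (\<lambda>x. \<forall>i<h x. P x i)"
proof -
  have "computable X (\<lambda>x. rec_nat (1::nat) (\<lambda>i r. if P x i then r else 0) (h x))"
    by (intro comp_intro assms decidable_comp2[OF assms(1)])
  moreover have "rec_nat (1::nat) (\<lambda>i r. if P x i then r else 0) m = of_bool (\<forall>i<m. P x i)" for x m
    by (induction m) (auto simp: less_Suc_eq)
  ultimately show ?thesis by (simp add: decidable_def)
qed

lemma decidable_ex_less [comp_intro]:
  fixes h :: "'a::enc \<Rightarrow> nat"
  assumes "decidable X (\<lambda>p. P (fst p) (snd p))" "computable X h"
  shows "decidable X (\<lambda>x. \<exists>i<h x. P x i)"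
proof -
  have "decidable X (\<lambda>x. \<not> (\<forall>i<h x. \<not> P x i))" by (intro comp_intro assms)
  then show ?thesis by simp
qed

section \<open>Lists, coded by pairing head and tail\<close>

lemma computable_Cons [comp_intro]:
  assumes "computable X f" "computable X g" shows "computable X (\<lambda>x. f x # g x)"
proof -
  have "computable X (\<lambda>x. Suc (enc (f x, g x)))" by (intro comp_intro assms)
  moreover have "enc (y # ys) = Suc (enc (y, ys))" for y :: 'b and ys
    by (simp add: enc_list_def enc_prod_def)
  ultimately show ?thesis by (simp add: computable_def)
qed

text \<open>The code of a nonempty list is the successor of the code of a pair, so head and tail are
  found by arithmetic.\<close>

lemma dec_prod_list_conv:
  "xs \<noteq> [] \<Longrightarrow> (dec (enc xs - 1) :: 'a \<times> 'a list) = (hd xs, tl xs)" for xs :: "'a::enc list"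
proof (cases xs)
  case (Cons y ys)
  then have "enc xs - 1 = enc (y, ys)" by (simp add: enc_list_def enc_prod_def)
  with Cons show ?thesis by (simp only: dec_enc list.sel)
qed simp

lemma computable_hd [comp_intro]:
  assumes "computable X f" shows "computable X (\<lambda>x. hd (f x))"
proof -
  \<comment> \<open>\<open>hd []\<close> is some fixed element and therefore computable as a
    constant.\<close>
  have "computable X (\<lambda>x. if f x = [] then hd [] else fst (dec (enc (f x) - 1) :: 'b \<times> 'b list))"
    by (intro comp_intro assms)
  moreover have "(if xs = [] then hd [] else fst (dec (enc xs - 1) :: 'b \<times> 'b list)) = hd xs"
    for xs :: "'b list" using dec_prod_list_conv[of xs] by auto
  ultimately show ?thesis by simp
qed

lemma computable_tl [comp_intro]:
  assumes "computable X f" shows "computable X (\<lambda>x. tl (f x))"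
proof -
  have "computable X (\<lambda>x. if f x = [] then [] else snd (dec (enc (f x) - 1) :: 'b \<times> 'b list))"
    by (intro comp_intro assms)
  moreover have "(if xs = [] then [] else snd (dec (enc xs - 1) :: 'b \<times> 'b list)) = tl xs"
    for xs :: "'b list" using dec_prod_list_conv[of xs] by auto
  ultimately show ?thesis by simp
qed

lemma computable_drop [comp_intro]:
  assumes "computable X f" "computable X g" shows "computable X (\<lambda>x. drop (f x) (g x))"
proof -
  have "computable X (\<lambda>x. rec_nat (g x) (\<lambda>_ r. tl r) (f x))" by (intro comp_intro assms)
  moreover have "rec_nat xs (\<lambda>_ r. tl r) n = drop n xs" for xs :: "'b list" and n
    by (induction n) (auto simp: drop_Suc tl_drop)
  ultimately show ?thesis by simp
qed

lemma computable_length [comp_intro]: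
  assumes "computable X f" shows "computable X (\<lambda>x. length (f x))"
proof -
  have "computable X (\<lambda>xs. LEAST n. drop n xs = ([] :: 'b list))"
    by (intro computable_Least comp_intro) auto
  moreover have "(LEAST n. drop n xs = []) = length xs" for xs :: "'b list"
    by (rule Least_equality) auto
  ultimately have "computable X (length :: 'b list \<Rightarrow> nat)" by simp
  from computable_comp[OF this assms] show ?thesis .
qed

lemma decidable_Bex_set [comp_intro]:
  assumes "decidable X (\<lambda>p. P (fst p) (snd p))" "computable X l"
  shows "decidable X (\<lambda>x. \<exists>y\<in>set (l x). P x y)"
proof -
  \<comment> \<open>List access is written as \<open>hd (drop i _)\<close>, a combination already
    known to be computable; within the length it agrees with \<open>!\<close>.\<close>
  have "decidable X (\<lambda>x. \<exists>i<length (l x). P x (hd (drop i (l x))))"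
    by (intro comp_intro assms decidable_comp2[OF assms(1)] computable_comp[OF assms(2)])
  moreover have "(\<exists>i<length (l x). P x (hd (drop i (l x)))) \<longleftrightarrow> (\<exists>y\<in>set (l x). P x y)" for x
    by (auto simp: hd_drop_conv_nth in_set_conv_nth Bex_def)
  ultimately show ?thesis by simp
qed

lemma decidable_Ball_set [comp_intro]:
  assumes "decidable X (\<lambda>p. P (fst p) (snd p))" "computable X l"
  shows "decidable X (\<lambda>x. \<forall>y\<in>set (l x). P x y)"
proof -
  have "decidable X (\<lambda>x. \<not> (\<exists>y\<in>set (l x). \<not> P x y))" by (intro comp_intro assms)
  then show ?thesis by simp
qed

lemma decidable_in_set [comp_intro]:
  assumes "computable X f" "computable X l"
  shows "decidable X (\<lambda>x. f x \<in> set (l x))"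
proof -
  have "decidable X (\<lambda>x. \<exists>y\<in>set (l x). y = f x)"
    by (intro comp_intro assms computable_comp[OF assms(1)])
  then show ?thesis by simp
qed

text \<open>Course-of-values recursion; the earlier values are listed in reverse order, because lists grow
  at the front.\<close>

lemma computable_course_of_values:
  assumes G: "computable X (\<lambda>p. G (fst p) (fst (snd p)) (snd (snd p)))"
    and h: "\<And>x c. h x c = G x c (rev (map (h x) [0..<c]))"
  shows "computable X (\<lambda>p. h (fst p) (snd p))"
proof -
  have "rev (map (h x) [0..<n]) = rec_nat [] (\<lambda>c l. G x c l # l) n" for x n
  proof (induction n)
    case (Suc n)
    then show ?case by (simp add: h[of x n] del: rev_map)
  qed simp
  then have "h x c = G x c (rec_nat [] (\<lambda>c l. G x c l # l) c)" for x c by (metis h)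
  moreover have "computable X (\<lambda>p. G (fst p) (snd p) (rec_nat [] (\<lambda>c l. G (fst p) c l # l) (snd p)))"
    by (intro computable_comp3[OF G] comp_intro)
  ultimately show ?thesis by simp
qed

text \<open>Lookup in the reversed history that a course-of-values step receives.\<close>

lemma hd_drop_rev_map:
  "d < c \<Longrightarrow> hd (drop (c - Suc d) (rev (map h [0..<c]))) = h d"
  by (subst hd_drop_conv_nth) (auto simp: rev_nth)

section \<open>Finite sets as binary numbers\<close>

lemma computable_pow2 [comp_intro]:
  assumes "computable X f" shows "computable X (\<lambda>x. 2 ^ f x :: nat)"
proof -
  have "computable X (\<lambda>x. rec_nat 1 (\<lambda>_ r. r + r :: nat) (f x))" by (intro comp_intro assms)
  moreover have "rec_nat 1 (\<lambda>_ r. r + r) n = (2::nat) ^ n" for n by (induction n) auto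
  ultimately show ?thesis by simp
qed

lemma computable_half [comp_intro]:
  assumes "computable X f" shows "computable X (\<lambda>x. f x div 2 :: nat)"
proof -
  \<comment> \<open>This is the recursion \<open>Suc n div 2 = n - n div 2\<close>.\<close>
  have "computable X (\<lambda>x. rec_nat 0 (\<lambda>n r. n - r) (f x))" by (intro comp_intro assms)
  moreover have "rec_nat 0 (\<lambda>n r. n - r) n = n div 2" for n :: nat by (induction n) auto
  ultimately show ?thesis by simp
qed

lemma decidable_set_decode [comp_intro]:
  assumes "computable X f" "computable X g" shows "decidable X (\<lambda>x. f x \<in> set_decode (g x))"
proof -
  have "computable X (\<lambda>x. rec_nat (g x) (\<lambda>_ r. r div 2) (f x))" by (intro comp_intro assms)
  moreover have "rec_nat w (\<lambda>_ r. r div 2) n = w div 2 ^ n" for w n :: nat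
    by (induction n) (simp_all flip: div_mult2_eq add: mult.commute)
  ultimately have q: "computable X (\<lambda>x. g x div 2 ^ f x)" by simp
  \<comment> \<open>Oddness of the shifted number, tested by comparing it with twice its
    half.\<close>
  have "decidable X (\<lambda>x. \<not> g x div 2 ^ f x = g x div 2 ^ f x div 2 + g x div 2 ^ f x div 2)"
    by (intro comp_intro q)
  moreover have "n = n div 2 + n div 2 \<longleftrightarrow> even n" for n :: nat by presburger
  ultimately show ?thesis by (simp add: set_decode_def)
qed

section \<open>A universal enumeration of the computations without oracle\<close>

text \<open>Since an index determines its program, runs recorded under the same code can be combined
  into one run.\<close>

lemma prog_code_inject: "prog_code p = prog_code q \<Longrightarrow> p = q"
proof (induction p arbitrary: q)
  case (PComp f gs)
  from PComp.prems obtain f' gs' where q: "q = PComp f' gs'"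
    and eq: "prog_code f = prog_code f'" "map prog_code gs = map prog_code gs'" by (cases q) (auto simp: list_encode_eq)
  have "gs = gs'" using eq(2) PComp.IH(2) by (metis list.inj_map_strong)
  with PComp.IH(1)[OF eq(1)] q show ?case by simp
next
  case (PPrec f g)
  then show ?case by (cases q) auto
next
  case (PMu f)
  then show ?case by (cases q) auto
qed (case_tac q; simp)+

text \<open>Constructor number and payload; program codes and formula codes share this
  shape.\<close>

definition tag :: "nat \<Rightarrow> nat" where "tag c = fst (prod_decode c)"
definition arg :: "nat \<Rightarrow> nat" where "arg c = snd (prod_decode c)"
definition arg1 :: "nat \<Rightarrow> nat" where "arg1 c = fst (prod_decode (arg c))"
definition arg2 :: "nat \<Rightarrow> nat" where "arg2 c = snd (prod_decode (arg c))"

lemma tag_arg_encode [simp]: "tag (prod_encode (a, b)) = a" "arg (prod_encode (a, b)) = b"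
  by (simp_all add: tag_def arg_def)

lemma arg12_encode [simp]:
  "arg1 (prod_encode (a, prod_encode (b, c))) = b" "arg2 (prod_encode (a, prod_encode (b, c))) = c"
  by (simp_all add: arg1_def arg2_def)

lemma encode_tag_arg: "prod_encode (tag c, arg c) = c"
  by (simp add: tag_def arg_def)

lemma encode_tag_args: "prod_encode (tag c, prod_encode (arg1 c, arg2 c)) = c"
  by (simp add: arg1_def arg2_def encode_tag_arg)

lemma prod_encode_code_cases:
  obtains a b where "c = prod_encode (a, b)"
  by (metis encode_tag_arg)

text \<open>Justifies recursion on codes: constructors with subexpressions have a nonzero tag, and
  pairing with a nonzero first component strictly increases the second.\<close>

lemma arg_less: "tag c \<noteq> 0 \<Longrightarrow> arg c < c"
proof -
  assume "tag c \<noteq> 0"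
  then obtain a where a: "tag c = Suc a" by (cases "tag c") auto
  have "b < prod_encode (Suc a, b)" for b
    using le_prod_encode_2[of b a] by (simp add: prod_encode_def)
  from this[of "arg c"] show ?thesis using a encode_tag_arg[of c] by metis
qed

lemma arg1_less: "tag c \<noteq> 0 \<Longrightarrow> arg1 c < c"
  and arg2_less: "tag c \<noteq> 0 \<Longrightarrow> arg2 c < c"
  using arg_less[of c] le_prod_encode_1[of "arg1 c" "arg2 c"] le_prod_encode_2[of "arg2 c" "arg1 c"]
  by (simp_all add: arg1_def arg2_def)

lemma mem_list_decode_le: "g \<in> set (list_decode n) \<Longrightarrow> g \<le> n"
proof -
  have "g \<in> set xs \<Longrightarrow> g \<le> list_encode xs" for xs
  proof (induction xs)
    case (Cons x xs)
    then show ?case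
      using le_prod_encode_1[of x "list_encode xs"] le_prod_encode_2[of "list_encode xs" x] by auto
  qed simp
  then show "g \<in> set (list_decode n) \<Longrightarrow> g \<le> n" by (metis list_decode_inverse)
qed

lemma computable_tag [comp_intro]: "computable X f \<Longrightarrow> computable X (\<lambda>x. tag (f x))"
  unfolding tag_def by (intro comp_intro)

lemma computable_arg [comp_intro]: "computable X f \<Longrightarrow> computable X (\<lambda>x. arg (f x))"
  unfolding arg_def by (intro comp_intro)

lemma computable_arg1 [comp_intro]: "computable X f \<Longrightarrow> computable X (\<lambda>x. arg1 (f x))"
  unfolding arg1_def by (intro comp_intro)

lemma computable_arg2 [comp_intro]: "computable X f \<Longrightarrow> computable X (\<lambda>x. arg2 (f x))"
  unfolding arg2_def by (intro comp_intro)

text \<open>One unfolding of the property of being a program code. The predicate \<open>Q\<close>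
  stands for the answers at smaller codes, so that they can be taken from a history list.\<close>

definition prog_code_step :: "(nat \<Rightarrow> bool) \<Rightarrow> nat \<Rightarrow> bool" where
  "prog_code_step Q c \<longleftrightarrow>
     (if tag c = 0 \<or> tag c = 1 \<or> tag c = 3 then arg c = 0
      else if tag c = 2 then True
      else if tag c = 4 then Q (arg1 c) \<and> (\<forall>g\<in>set (list_decode (arg2 c)). Q g)
      else if tag c = 5 then Q (arg1 c) \<and> Q (arg2 c)
      else tag c = 6 \<and> Q (arg c))"

lemma prog_code_step_range: "c \<in> range prog_code \<longleftrightarrow> prog_code_step (\<lambda>d. d \<in> range prog_code) c"
proof
  assume "c \<in> range prog_code"
  then obtain p where "c = prog_code p" by auto
  then show "prog_code_step (\<lambda>d. d \<in> range prog_code) c"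
    by (cases p) (auto simp: prog_code_step_def)
next
  assume step: "prog_code_step (\<lambda>d. d \<in> range prog_code) c"
  obtain a b where c: "c = prod_encode (a, b)" by (rule prod_encode_code_cases)
  obtain b1 b2 where b: "b = prod_encode (b1, b2)" by (rule prod_encode_code_cases)
  have "a = 0 \<or> a = 1 \<or> a = 2 \<or> a = 3 \<or> a = 4 \<or> a = 5 \<or> a = 6"
    by (rule ccontr) (use step in \<open>simp add: prog_code_step_def c\<close>)
  then consider "a = 0" | "a = 1" | "a = 2" | "a = 3" | "a = 4" | "a = 5" | "a = 6" by blast
  then show "c \<in> range prog_code"
  proof cases
    case 1
    with step have "c = prog_code PZero" by (simp add: prog_code_step_def c)
    then show ?thesis by (metis rangeI)
  next
    case 2
    with step have "c = prog_code PSucc" by (simp add: prog_code_step_def c)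
    then show ?thesis by (metis rangeI)
  next
    case 3
    then have "c = prog_code (PProj b)" by (simp add: c)
    then show ?thesis by (metis rangeI)
  next
    case 4
    with step have "c = prog_code POracle" by (simp add: prog_code_step_def c)
    then show ?thesis by (metis rangeI)
  next
    case 5
    with step have "b1 \<in> range prog_code" "\<forall>g\<in>set (list_decode b2). \<exists>p. g = prog_code p"
      by (auto simp: prog_code_step_def c b)
    then obtain f gs where "b1 = prog_code f" "list_decode b2 = map prog_code gs"
      using ex_map_conv[of "list_decode b2" prog_code] by auto
    then have "c = prog_code (PComp f gs)"
      using 5 by (simp add: c b) (metis list_decode_inverse)
    then show ?thesis by (metis rangeI)
  next
    case 6
    with step obtain f g where "b1 = prog_code f" "b2 = prog_code g"
      by (auto simp: prog_code_step_def c b)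
    then have "c = prog_code (PPrec f g)" using 6 by (simp add: c b)
    then show ?thesis by (metis rangeI)
  next
    case 7
    with step obtain f where "b = prog_code f" by (auto simp: prog_code_step_def c)
    then have "c = prog_code (PMu f)" using 7 by (simp add: c)
    then show ?thesis by (metis rangeI)
  qed
qed

lemma prog_code_step_cong:
  "(\<And>d. d < c \<Longrightarrow> Q d \<longleftrightarrow> Q' d) \<Longrightarrow> prog_code_step Q c \<longleftrightarrow> prog_code_step Q' c"
  unfolding prog_code_step_def
  using arg_less[of c] arg1_less[of c] arg2_less[of c] mem_list_decode_le[of _ "arg2 c"]
  by (smt (verit, best) le_less_trans zero_neq_numeral)

text \<open>Primitive recursion at 0 never runs its step program, so a derivation does not by itself
  certify that the step component codes a program; this has to be tested separately.\<close>

lemma decidable_range_prog_code [comp_intro]: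
  assumes "computable X f" shows "decidable X (\<lambda>x. f x \<in> range prog_code)"
proof -
  \<comment> \<open>The first argument is a dummy for the parameter of course-of-values
    recursion.\<close>
  let ?h = "\<lambda>(_::nat) c. of_bool (c \<in> range prog_code) :: nat"
  let ?G = "\<lambda>(_::nat) c l. of_bool (prog_code_step (\<lambda>d. hd (drop (c - Suc d) l) \<noteq> (0::nat)) c) :: nat"
  have "computable X (\<lambda>p. ?h (fst p) (snd p))"
  proof (rule computable_course_of_values[where h = ?h and G = ?G])
    show "computable X (\<lambda>p. ?G (fst p) (fst (snd p)) (snd (snd p)))"
      unfolding decidable_def[symmetric] prog_code_step_def by (intro comp_intro)
    show "?h x c = ?G x c (rev (map (?h x) [0..<c]))" for x :: nat and c
    proof -
      have "prog_code_step (\<lambda>d. d \<in> range prog_code) c \<longleftrightarrow>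
          prog_code_step (\<lambda>d. hd (drop (c - Suc d) (rev (map (?h x) [0..<c]))) \<noteq> 0) c"
        by (rule prog_code_step_cong) (subst hd_drop_rev_map, simp_all)
      then show ?thesis using prog_code_step_range[of c] by simp
    qed
  qed
  then have "decidable X (\<lambda>p::nat \<times> nat. snd p \<in> range prog_code)" by (simp add: decidable_def)
  from decidable_comp[OF this, of "\<lambda>x. (0, f x)"] show ?thesis
    using assms by (simp add: computable_Pair computable_const)
qed

text \<open>One clause per rule of \<open>computes {}\<close>, so an oracle query (tag 3) returns 0.
  All quantifiers range over entries of \<open>L\<close> or below a given number, which keeps the
  relation decidable.\<close>

definition justified :: "(nat \<times> nat list \<times> nat) list \<Rightarrow> nat \<Rightarrow> nat list \<Rightarrow> nat \<Rightarrow> bool" where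
  "justified L c xs y \<longleftrightarrow>
     (if tag c = 0 then arg c = 0 \<and> y = 0
      else if tag c = 1 then arg c = 0 \<and> length xs = 1 \<and> y = Suc (hd xs)
      else if tag c = 2 then arg c < length xs \<and> y = hd (drop (arg c) xs)
      else if tag c = 3 then arg c = 0 \<and> length xs = 1 \<and> y = 0
      else if tag c = 4 then
        (\<exists>t\<in>set L. fst t = arg1 c \<and> snd (snd t) = y \<and>
          length (fst (snd t)) = length (list_decode (arg2 c)) \<and>
          (\<forall>i<length (fst (snd t)).
            (hd (drop i (list_decode (arg2 c))), xs, hd (drop i (fst (snd t)))) \<in> set L))
      else if tag c = 5 then xs \<noteq> [] \<and>
        (if hd xs = 0 then (arg1 c, tl xs, y) \<in> set L \<and> arg2 c \<in> range prog_code
         else \<exists>t\<in>set L. fst t = c \<and> fst (snd t) = (hd xs - 1) # tl xs \<and>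
           (arg2 c, (hd xs - 1) # snd (snd t) # tl xs, y) \<in> set L)
      else tag c = 6 \<and> (arg c, y # xs, 0) \<in> set L \<and>
        (\<forall>m<y. \<exists>t\<in>set L. fst t = arg c \<and> fst (snd t) = m # xs \<and> snd (snd t) \<noteq> 0))"

text \<open>A derivation for \<^const>\<open>computes\<close> without oracle, written as the list of its conclusions
  (program code, input, output), each of which is justified by the entries after it.\<close>

definition valid_computation :: "(nat \<times> nat list \<times> nat) list \<Rightarrow> bool" where
  "valid_computation L \<longleftrightarrow> (\<forall>i<length L. justified (drop (Suc i) L)
     (fst (hd (drop i L))) (fst (snd (hd (drop i L)))) (snd (snd (hd (drop i L)))))"

lemma valid_computation_Nil: "valid_computation []"
  by (simp add: valid_computation_def)

lemma valid_computation_Cons: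
  "valid_computation (t # L) \<longleftrightarrow> justified L (fst t) (fst (snd t)) (snd (snd t)) \<and> valid_computation L"
  unfolding valid_computation_def by (simp only: length_Cons All_less_Suc2) simp

text \<open>Membership in \<open>L\<close> occurs only positively in
  \<open>justified\<close>.\<close>

lemma justified_mono:
  "justified L c xs y \<Longrightarrow> set L \<subseteq> set L' \<Longrightarrow> justified L' c xs y"
  unfolding justified_def by (simp split: if_splits) (blast+)

lemma valid_computation_append:
  "valid_computation L \<Longrightarrow> valid_computation L' \<Longrightarrow> valid_computation (L @ L')"
proof (induction L)
  case (Cons t L)
  then show ?case by (auto simp: valid_computation_Cons intro: justified_mono)
qed simp

lemma valid_computation_sound:
  assumes "valid_computation L" "(c, xs, y) \<in> set L"
  shows "\<exists>p. prog_code p = c \<and> computes {} p xs y"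
  using assms
proof (induction L arbitrary: c xs y)
  case (Cons t L)
  have valid: "valid_computation L"
    and IH: "\<And>c xs y. (c, xs, y) \<in> set L \<Longrightarrow> \<exists>p. prog_code p = c \<and> computes {} p xs y"
    using Cons by (auto simp: valid_computation_Cons)
  show ?case
  proof (cases "t = (c, xs, y)")
    case False
    with Cons.prems IH show ?thesis by simp
  next
    case True
    with Cons.prems have j: "justified L c xs y" by (simp add: valid_computation_Cons)
    obtain a b where c: "c = prod_encode (a, b)" by (rule prod_encode_code_cases)
    obtain b1 b2 where b: "b = prod_encode (b1, b2)" by (rule prod_encode_code_cases)
    note j' = j[unfolded justified_def c tag_arg_encode]
    have "a = 0 \<or> a = 1 \<or> a = 2 \<or> a = 3 \<or> a = 4 \<or> a = 5 \<or> a = 6"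
      by (rule ccontr) (use j' in simp)
    then consider "a = 0" | "a = 1" | "a = 2" | "a = 3" | "a = 4" | "a = 5" "hd xs = 0"
      | "a = 5" "hd xs \<noteq> 0" | "a = 6" by blast
    then show ?thesis
    proof cases
      case 1
      with j' show ?thesis by (auto simp: c intro!: exI[of _ PZero] computes.zero)
    next
      case 2
      with j' have "xs = [hd xs]" "y = Suc (hd xs)" "b = 0" by (auto simp: length_Suc_conv)
      then show ?thesis using 2 computes.succ[of "{}" "hd xs"]
        by (auto simp: c intro!: exI[of _ PSucc])
    next
      case 3
      with j' show ?thesis
        by (auto simp: c hd_drop_conv_nth intro!: exI[of _ "PProj b"] computes.proj)
    next
      case 4
      with j' have "xs = [hd xs]" "y = 0" "b = 0" by (auto simp: length_Suc_conv)
      then show ?thesis using 4 computes.orac[of "{}" "hd xs"]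
        by (auto simp: c intro!: exI[of _ POracle])
    next
      case 5
      with j' obtain ys where f: "(b1, ys, y) \<in> set L" and len: "length ys = length (list_decode b2)"
        and gs: "\<And>i. i < length ys \<Longrightarrow> (hd (drop i (list_decode b2)), xs, hd (drop i ys)) \<in> set L"
        by (auto simp: b)
      obtain p where p: "prog_code p = b1" "computes {} p ys y" using IH[OF f] by auto
      have "\<forall>i<length ys. \<exists>q. prog_code q = list_decode b2 ! i \<and> computes {} q xs (ys ! i)"
        using gs IH len by (metis hd_drop_conv_nth)
      then obtain q where q: "\<And>i. i < length ys \<Longrightarrow>
          prog_code (q i) = list_decode b2 ! i \<and> computes {} (q i) xs (ys ! i)" by metis
      have "map prog_code (map q [0..<length ys]) = list_decode b2"
        using len q by (auto intro!: nth_equalityI)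
      then have "prog_code (PComp p (map q [0..<length ys])) = c"
        using 5 p by (simp add: c b)
      moreover have "computes {} (PComp p (map q [0..<length ys])) xs y"
        by (rule computes.comp[OF _ p(2)]) (auto simp: list_all2_conv_all_nth q)
      ultimately show ?thesis by blast
    next
      case 6
      with j' have f: "(b1, tl xs, y) \<in> set L" and g: "b2 \<in> range prog_code"
        and xs: "xs = 0 # tl xs" by (cases xs; auto simp: b)+
      from IH[OF f] g obtain p q where p: "prog_code p = b1" "computes {} p (tl xs) y"
        and q: "b2 = prog_code q" by auto
      have "computes {} (PPrec p q) xs y" by (subst xs, rule computes.prec_0[OF p(2)])
      moreover have "prog_code (PPrec p q) = c" using 6 p q by (simp add: c b)
      ultimately show ?thesis by blast
    next
      case 7
      with j' obtain n r where f: "(c, n # tl xs, r) \<in> set L"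
        and g: "(b2, n # r # tl xs, y) \<in> set L" and xs: "xs = Suc n # tl xs"
        by (cases xs) (auto simp: b c gr0_conv_Suc)
      from IH[OF f] IH[OF g] obtain p q where p: "prog_code p = c" "computes {} p (n # tl xs) r"
        and q: "b2 = prog_code q" "computes {} q (n # r # tl xs) y" by auto
      obtain p1 p2 where p12: "p = PPrec p1 p2" using p(1) 7 by (cases p) (auto simp: c)
      \<comment> \<open>The entry for the step yields some program with code \<open>b2\<close>;
        injectivity identifies it with the second component of \<open>p\<close>.\<close>
      have "q = p2" using p(1) q(1) by (intro prog_code_inject) (simp add: p12 c b)
      with p p12 q have "computes {} p (Suc n # tl xs) y" by (auto intro: computes.prec_Suc)
      then have "computes {} p xs y" using xs by simp
      with p show ?thesis by blast
    next
      case 8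
      with j' have f: "(b, y # xs, 0) \<in> set L"
        and *: "\<forall>m<y. \<exists>t\<in>set L. fst t = b \<and> fst (snd t) = m # xs \<and> snd (snd t) \<noteq> 0"
        by simp_all
      have g: "\<exists>k. (b, m # xs, Suc k) \<in> set L" if m: "m < y" for m
      proof -
        obtain t where "t \<in> set L" "fst t = b" "fst (snd t) = m # xs" "snd (snd t) \<noteq> 0"
          using * m by blast
        then show ?thesis by (metis not0_implies_Suc prod.collapse)
      qed
      from IH[OF f] obtain p where p: "prog_code p = b" "computes {} p (y # xs) 0" by auto
      have "\<exists>k. computes {} p (m # xs) (Suc k)" if m: "m < y" for m
        using g[OF m] IH p(1) prog_code_inject by blast
      with p have "computes {} (PMu p) xs y" by (intro computes.mu) auto
      moreover have "prog_code (PMu p) = c" using 8 p by (simp add: c)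
      ultimately show ?thesis by blast
    qed
  qed
qed simp

section \<open>Every halting computation has a derivation list\<close>

definition derivable :: "nat \<Rightarrow> nat list \<Rightarrow> nat \<Rightarrow> bool" where
  "derivable c xs y \<longleftrightarrow> (\<exists>L. valid_computation L \<and> (c, xs, y) \<in> set L)"

text \<open>Concatenation preserves validity, so the premises of a rule, whose number is unbounded
  for composition and minimization, can be read off a single list.\<close>

lemma derivable_finite:
  assumes "finite S" "\<And>c xs y. (c, xs, y) \<in> S \<Longrightarrow> derivable c xs y"
  shows "\<exists>L. valid_computation L \<and> S \<subseteq> set L"
  using assms
proof (induction S rule: finite_induct)
  case empty
  then show ?case using valid_computation_Nil by auto
next
  case (insert t S)
  then obtain L where L: "valid_computation L" "S \<subseteq> set L" by auto
  obtain L' where L': "valid_computation L'" "t \<in> set L'"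
    using insert.prems by (metis derivable_def insertI1 prod.collapse)
  show ?case using valid_computation_append[OF L(1) L'(1)] L(2) L'(2) by (intro exI[of _ "L @ L'"]) auto
qed

lemma derivableI:
  assumes "finite S" "\<And>c xs y. (c, xs, y) \<in> S \<Longrightarrow> derivable c xs y"
    and "\<And>L. S \<subseteq> set L \<Longrightarrow> justified L c xs y"
  shows "derivable c xs y"
proof -
  obtain L where L: "valid_computation L" "S \<subseteq> set L" using derivable_finite[OF assms(1,2)] by blast
  then have "valid_computation ((c, xs, y) # L)" by (simp add: valid_computation_Cons assms(3))
  then show ?thesis by (auto simp: derivable_def)
qed

lemma computes_derivable:
  "computes {} p xs y \<Longrightarrow> derivable (prog_code p) xs y"
proof (induction rule: computes.induct)
  case (zero xs)
  show ?case by (rule derivableI[of "{}"]) (auto simp: justified_def)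
next
  case (succ x)
  show ?case by (rule derivableI[of "{}"]) (auto simp: justified_def)
next
  case (proj i xs)
  show ?case
    by (rule derivableI[of "{}"]) (use proj in \<open>auto simp: justified_def hd_drop_conv_nth\<close>)
next
  case (orac x)
  show ?case by (rule derivableI[of "{}"]) (auto simp: justified_def)
next
  case (comp xs gs ys f z)
  then have len: "length ys = length gs"
    and gs: "\<And>i. i < length gs \<Longrightarrow> derivable (prog_code (gs ! i)) xs (ys ! i)"
    by (auto simp: list_all2_conv_all_nth)
  show ?case
  proof (rule derivableI[of "insert (prog_code f, ys, z)
      ((\<lambda>i. (prog_code (gs ! i), xs, ys ! i)) ` {..<length gs})"])
    fix L assume "insert (prog_code f, ys, z)
      ((\<lambda>i. (prog_code (gs ! i), xs, ys ! i)) ` {..<length gs}) \<subseteq> set L"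
    then show "justified L (prog_code (PComp f gs)) xs z"
      by (auto simp: justified_def len hd_drop_conv_nth intro!: bexI[of _ "(prog_code f, ys, z)"])
  qed (use comp gs in auto)
next
  case (prec_0 f xs y g)
  show ?case
    by (rule derivableI[of "{(prog_code f, xs, y)}"])
      (use prec_0 in \<open>auto simp: justified_def\<close>)
next
  case (prec_Suc f g n xs r y)
  show ?case
    by (rule derivableI[of "{(prog_code (PPrec f g), n # xs, r), (prog_code g, n # r # xs, y)}"])
      (use prec_Suc in \<open>auto simp: justified_def
        intro!: bexI[of _ "(prog_code (PPrec f g), n # xs, r)"]\<close>)
next
  case (mu f n xs)
  then obtain k where k: "\<And>m. m < n \<Longrightarrow> derivable (prog_code f) (m # xs) (Suc (k m))" by metis
  show ?case
  proof (rule derivableI[of "insert (prog_code f, n # xs, 0)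
      ((\<lambda>m. (prog_code f, m # xs, Suc (k m))) ` {..<n})"])
    fix L assume L: "insert (prog_code f, n # xs, 0)
      ((\<lambda>m. (prog_code f, m # xs, Suc (k m))) ` {..<n}) \<subseteq> set L"
    have "\<exists>t\<in>set L. fst t = prog_code f \<and> fst (snd t) = m # xs \<and> snd (snd t) \<noteq> 0" if "m < n" for m
      using L that by (intro bexI[of _ "(prog_code f, m # xs, Suc (k m))"]) auto
    with L show "justified L (prog_code (PMu f)) xs n" by (simp add: justified_def)
  qed (use mu k in auto)
qed

definition halts_by :: "nat \<Rightarrow> nat \<Rightarrow> nat \<Rightarrow> bool" where
  "halts_by e x t \<longleftrightarrow> valid_computation (dec t) \<and>
     (\<exists>u\<in>set (dec t :: (nat \<times> nat list \<times> nat) list). fst u = e \<and> fst (snd u) = [x])"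

lemma W_iff_halts_by: "x \<in> W e \<longleftrightarrow> (\<exists>t. halts_by e x t)"
proof
  assume "x \<in> W e"
  then obtain p y where "prog_code p = e" "computes {} p [x] y" by (auto simp: W_def)
  then obtain L where "valid_computation L" "(e, [x], y) \<in> set L"
    using computes_derivable unfolding derivable_def by blast
  then have "halts_by e x (enc L)" by (auto simp: halts_by_def intro!: bexI[of _ "(e, [x], y)"])
  then show "\<exists>t. halts_by e x t" ..
next
  assume "\<exists>t. halts_by e x t"
  then obtain L y where "valid_computation L" "(e, [x], y) \<in> set L"
    unfolding halts_by_def by (metis prod.collapse)
  then show "x \<in> W e" using valid_computation_sound by (fastforce simp: W_def)
qed

lemma decidable_justified:
  "decidable X (\<lambda>p. justified (fst p) (fst (snd p)) (fst (snd (snd p))) (snd (snd (snd p))))"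
  unfolding justified_def by (intro comp_intro)

lemma decidable_valid_computation: "decidable X valid_computation"
proof -
  have "computable X (\<lambda>p::_ \<times> nat.
      (drop (Suc (snd p)) (fst p), hd (drop (snd p) (fst p) :: (nat \<times> nat list \<times> nat) list)))"
    by (intro comp_intro)
  from decidable_comp[OF decidable_justified this] show ?thesis
    unfolding valid_computation_def fst_conv snd_conv by (intro comp_intro)
qed

lemma decidable_halts_by [comp_intro]:
  assumes "computable X f" "computable X g" "computable X h"
  shows "decidable X (\<lambda>x. halts_by (f x) (g x) (h x))"
  by (rule decidable_comp3[OF _ assms])
    (unfold halts_by_def, intro comp_intro decidable_comp[OF decidable_valid_computation])

section \<open>Indices of RE sets depending computably on a parameter\<close>

primrec const_prog :: "nat \<Rightarrow> prog" where
  "const_prog 0 = PZero"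
| "const_prog (Suc n) = PComp PSucc [const_prog n]"

lemma computes_const_prog: "computes X (const_prog n) xs n"
  by (induction n) (auto intro: computes.zero computes.succ intro!: computes.comp[where ys = "[_]"])

lemma computable_prog_code_const_prog [comp_intro]:
  assumes "computable X f" shows "computable X (\<lambda>x. prog_code (const_prog (f x)))"
proof -
  have "prog_code (const_prog n) = rec_nat (prod_encode (0, 0))
      (\<lambda>_ r. prod_encode (4, prod_encode (prod_encode (1, 0), list_encode [r]))) n" for n
    by (induction n) auto
  moreover have "computable X (\<lambda>x. rec_nat (prod_encode (0, 0))
      (\<lambda>_ r. prod_encode (4, prod_encode (prod_encode (1, 0), list_encode [r]))) (f x))"
    by (intro comp_intro assms)
  ultimately show ?thesis by simp
qed

text \<open>The s-m-n theorem.\<close>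

lemma W_uniform:
  fixes P :: "nat \<Rightarrow> nat \<Rightarrow> nat \<Rightarrow> bool"
  assumes P: "decidable {} (\<lambda>p. P (fst p) (fst (snd p)) (snd (snd p)))"
  shows "\<exists>g. computable {} g \<and> (\<forall>e. W (g e) = {x. \<exists>s. P e x s})"
proof -
  define Q where "Q z s \<longleftrightarrow> P (fst z) (snd z) s" for z :: "nat \<times> nat" and s
  \<comment> \<open>The test is negated because minimization searches for the value 0.\<close>
  have "decidable {} (\<lambda>p::nat \<times> nat \<times> nat. \<not> Q (snd p) (fst p))"
    unfolding Q_def by (intro comp_intro decidable_comp3[OF P])
  then have Q: "computable {} (\<lambda>p::nat \<times> nat \<times> nat. of_bool (\<not> Q (snd p) (fst p)) :: nat)"
    by (simp only: decidable_def)
  have "tuple_computable {} 2 (\<lambda>ys. enc (ys ! 0, dec (ys ! 1) :: nat \<times> nat))"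
    unfolding enc_prod_def[of "(_, _ :: nat \<times> nat)"] fst_conv snd_conv enc_dec enc_nat_def
    by (intro tuple_computable_prod_encode tuple_computable_nth) auto
  from tuple_computable_enc[OF Q this] obtain q where
    q: "\<And>ys. length ys = 2 \<Longrightarrow> computes {} q ys (of_bool (\<not> Q (dec (ys ! 1)) (ys ! 0)))"
    by (auto simp: tuple_computable_def simp del: of_bool_not_iff)
  have q: "computes {} q [s, enc z] (of_bool (\<not> Q z s))" for s z
    using q[of "[s, enc z]"] by simp
  have halt: "(\<exists>y. computes {} (PMu q) [enc z] y) \<longleftrightarrow> (\<exists>s. Q z s)" for z
  proof
    assume "\<exists>y. computes {} (PMu q) [enc z] y"
    then obtain y where "computes {} q [y, enc z] 0" by (auto elim: computes_PMuE)
    then have "of_bool (\<not> Q z y) = (0::nat)" using q computes_deterministic by blast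
    then show "\<exists>s. Q z s" by (auto split: if_splits)
  next
    assume ex: "\<exists>s. Q z s"
    define s where "s = (LEAST s. Q z s)"
    have "computes {} q [s, enc z] 0" using q[of s z] LeastI_ex[OF ex] by (simp add: s_def)
    moreover have "computes {} q [m, enc z] (Suc 0)" if "m < s" for m
      using q[of m z] not_less_Least[of m "Q z"] that by (simp add: s_def)
    ultimately show "\<exists>y. computes {} (PMu q) [enc z] y" using computes.mu by blast
  qed
  have "tuple_computable {} 2 (\<lambda>ys. prod_encode (ys ! 0, ys ! 1))"
    by (intro tuple_computable_prod_encode tuple_computable_nth) auto
  then obtain pr where "\<And>ys. length ys = 2 \<Longrightarrow> computes {} pr ys (prod_encode (ys ! 0, ys ! 1))"
    by (auto simp: tuple_computable_def)
  then have pr: "computes {} pr [a, b] (enc (a, b))" for a b :: nat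
    by (metis enc_nat_pair length_Cons list.size(3) nth_Cons_0 nth_Cons_Suc One_nat_def numeral_2_eq_2)
  \<comment> \<open>The parameter \<open>e\<close> is hard-wired as a constant program. Nothing else
    depends on \<open>e\<close>, so the code is computable from it.\<close>
  define prg where "prg e = PComp (PMu q) [PComp pr [const_prog e, PProj 0]]" for e
  have pair: "computes {} (PComp pr [const_prog e, PProj 0]) [x] (enc (e, x))" for e x
    by (rule computes.comp[where ys = "[e, x]"])
      (use computes.proj[of 0 "[x]"] in \<open>auto intro: computes_const_prog pr\<close>)
  have halt_prg: "(\<exists>y. computes {} (prg e) [x] y) \<longleftrightarrow> (\<exists>s. P e x s)" for e x
  proof -
    have "(\<exists>y. computes {} (prg e) [x] y) \<longleftrightarrow> (\<exists>y. computes {} (PMu q) [enc (e, x)] y)"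
    proof
      assume "\<exists>y. computes {} (prg e) [x] y"
      then obtain y ys where
        "list_all2 (\<lambda>g y. computes {} g [x] y) [PComp pr [const_prog e, PProj 0]] ys"
        "computes {} (PMu q) ys y" unfolding prg_def by (auto elim: computes_PCompE)
      \<comment> \<open>By determinism, a halting run can only have passed this intermediate value
        on to the search.\<close>
      moreover from this have "ys = [enc (e, x)]"
        using computes_deterministic[OF pair] by (auto simp: list_all2_Cons1)
      ultimately show "\<exists>y. computes {} (PMu q) [enc (e, x)] y" by auto
    next
      assume "\<exists>y. computes {} (PMu q) [enc (e, x)] y"
      then show "\<exists>y. computes {} (prg e) [x] y"
        unfolding prg_def using pair by (auto intro!: computes.comp[where ys = "[_]"])
    qed
    then show ?thesis by (simp add: halt Q_def)
  qed
  have "W (prog_code (prg e)) = {x. \<exists>s. P e x s}" for e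
    unfolding W_def halt_prg[symmetric] by (auto dest: prog_code_inject)
  moreover have "computable {} (\<lambda>e. prog_code (prg e))"
    unfolding prg_def prog_code.simps list.map by (intro comp_intro)
  ultimately show ?thesis by blast
qed

lemma W_semidecidable:
  fixes P :: "nat \<Rightarrow> nat \<Rightarrow> bool"
  assumes "decidable {} (\<lambda>p. P (fst p) (snd p))"
  shows "\<exists>j. W j = {x. \<exists>s. P x s}"
proof -
  have "decidable {} (\<lambda>p::nat \<times> nat \<times> nat. P (fst (snd p)) (snd (snd p)))"
    by (intro decidable_comp2[OF assms] comp_intro)
  from W_uniform[OF this] show ?thesis by blast
qed

section \<open>Theories of propositional letters\<close>

text \<open>Truth in the structure with one element in which the letters in \<open>v\<close> hold.\<close>

primrec truth :: "nat set \<Rightarrow> fm \<Rightarrow> bool" where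
  "truth v Falsum \<longleftrightarrow> False"
| "truth v (Eq s t) \<longleftrightarrow> True"
| "truth v (Rel r ts) \<longleftrightarrow> r \<in> v"
| "truth v (Imp \<phi> \<psi>) \<longleftrightarrow> (truth v \<phi> \<longrightarrow> truth v \<psi>)"
| "truth v (All \<phi>) \<longleftrightarrow> truth v \<phi>"

lemma truth_subst [simp]: "truth v (subst \<sigma> \<phi>) \<longleftrightarrow> truth v \<phi>"
  by (induction \<phi> arbitrary: \<sigma>) auto

text \<open>Soundness, for open formulas as well: with one element, quantifiers and substitutions
  are invisible to \<open>truth\<close>, so the quantifier and equality axioms become propositional
  tautologies.\<close>

lemma proves_truth: "\<Gamma> \<turnstile> \<phi> \<Longrightarrow> (\<And>\<psi>. \<psi> \<in> \<Gamma> \<Longrightarrow> truth v \<psi>) \<Longrightarrow> truth v \<phi>"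
  by (induction rule: proves.induct) (auto simp: inst_def shift_def)

lemma truth_cong:
  "(\<And>r k. RelSym r k \<in> syms \<phi> \<Longrightarrow> r \<in> v \<longleftrightarrow> r \<in> v') \<Longrightarrow> truth v \<phi> \<longleftrightarrow> truth v' \<phi>"
  by (induction \<phi>) auto

lemma truth_Exi_power: "truth v ((Exi ^^ n) \<phi>) \<longleftrightarrow> truth v \<phi>"
  by (induction n) auto

lemma truth_conjs: "truth v (conjs \<phi>s) \<longleftrightarrow> (\<forall>\<phi>\<in>set \<phi>s. truth v \<phi>)"
  unfolding conjs_def by (induction \<phi>s) auto

section \<open>Numerals of R in one-element structures\<close>

lemma free_num [simp]: "free_tm (num n) = {}"
  by (induction n) (auto simp: num_def)

lemma syms_num: "syms_tm (num n) \<subseteq> lang theory_R"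
  by (induction n) (auto simp: num_def theory_R_def)

text \<open>Its translation is a way to state that the numeral has a value in the interpreted
  domain.\<close>

lemma num_eq_num_theorem: "Eq (num n) (num n) \<in> theorems theory_R"
  using syms_num[of n] by (auto simp: theorems_def sentence_of_def intro: proves.Eq_refl)

text \<open>Whatever the translation of equality, in a one-element structure it holds between any two
  terms that have a value.\<close>

lemma one_element_model_not_interprets_R:
  assumes "\<And>\<phi>. \<phi> \<in> axioms S \<Longrightarrow> truth v \<phi>"
  shows "\<not> interprets S theory_R"
proof
  assume "interprets S theory_R"
  then obtain I where "\<And>\<phi>. \<phi> \<in> theorems theory_R \<Longrightarrow> axioms S \<turnstile> translate I \<phi>"
    by (auto simp: interprets_def)
  then have I: "truth v (translate I \<phi>)" if "\<phi> \<in> theorems theory_R" for \<phi>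
    using proves_truth[of "axioms S" _ v] assms that by blast
  \<comment> \<open>Once the existential prefix and the renamings are invisible, the two sides of
    the equation contribute independent conjuncts.\<close>
  have Eq: "truth v (translate I (Eq s t)) \<longleftrightarrow> truth v (dom_fm I) \<and>
      truth v (val_fm I s (\<lambda>n. n + 2) 0) \<and> truth v (val_fm I t (\<lambda>n. n + 2) 1) \<and> truth v (eq_fm I)"
    for s t
    by (auto simp: with_values_def truth_Exi_power truth_conjs upt_rec numeral_2_eq_2
        simp del: funpow.simps)
  have "Neg (Eq (num 0) (num 1)) \<in> axioms theory_R"
    by (auto simp: theory_R_def)
  then have "Neg (Eq (num 0) (num 1)) \<in> theorems theory_R"
    using syms_num[of 0] syms_num[of 1] by (auto simp: theorems_def sentence_of_def intro: proves.Ax)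
  from I[OF this] have "\<not> truth v (translate I (Eq (num 0) (num 1)))"
    by (simp only: translate.simps truth.simps) simp
  \<comment> \<open>The left conjunct comes from \<open>num 0 = num 0\<close>, the right one from
    \<open>num 1 = num 1\<close>; the rest is common to both.\<close>
  moreover have "truth v (translate I (Eq (num 0) (num 1)))"
    using I[OF num_eq_num_theorem[of 0]] I[OF num_eq_num_theorem[of 1]] by (simp only: Eq)
  ultimately show False by simp
qed

section \<open>Theories prescribing true and false letters\<close>

definition letters :: "sym set" where "letters = range (\<lambda>n. RelSym n 0)"

definition letter :: "nat \<Rightarrow> fm" where "letter n = Rel n []"

text \<open>With every valid sentence as an axiom, provability equals validity in these structures
  by soundness alone, and no completeness theorem is called for.\<close>

definition letter_theory :: "nat set \<Rightarrow> nat set \<Rightarrow> fo_theory" where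
  "letter_theory B C = \<lparr>lang = letters, axioms = {\<phi>. sentence_of letters \<phi> \<and>
     (\<forall>v. B \<subseteq> v \<and> C \<inter> v = {} \<longrightarrow> truth v \<phi>)}\<rparr>"

lemma lang_letter_theory [simp]: "lang (letter_theory B C) = letters"
  by (simp add: letter_theory_def)

lemma is_theory_letter_theory: "is_theory (letter_theory B C)"
  by (simp add: is_theory_def letter_theory_def)

lemma truth_letter_theory:
  "\<phi> \<in> axioms (letter_theory B C) \<Longrightarrow> B \<subseteq> v \<Longrightarrow> C \<inter> v = {} \<Longrightarrow> truth v \<phi>"
  by (simp add: letter_theory_def)

lemma proves_letter_theory:
  assumes "sentence_of letters \<phi>"
  shows "axioms (letter_theory B C) \<turnstile> \<phi> \<longleftrightarrow> (\<forall>v. B \<subseteq> v \<and> C \<inter> v = {} \<longrightarrow> truth v \<phi>)"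
proof
  show "axioms (letter_theory B C) \<turnstile> \<phi> \<Longrightarrow> \<forall>v. B \<subseteq> v \<and> C \<inter> v = {} \<longrightarrow> truth v \<phi>"
    using proves_truth truth_letter_theory by blast
  show "\<forall>v. B \<subseteq> v \<and> C \<inter> v = {} \<longrightarrow> truth v \<phi> \<Longrightarrow> axioms (letter_theory B C) \<turnstile> \<phi>"
    by (rule proves.Ax) (use assms in \<open>auto simp: letter_theory_def\<close>)
qed

text \<open>The valuation \<open>B\<close> is itself a model.\<close>

lemma consistent_letter_theory: "B \<inter> C = {} \<Longrightarrow> consistent (letter_theory B C)"
  unfolding consistent_def using proves_truth[of "axioms (letter_theory B C)" Falsum B]
    truth_letter_theory[of _ B C B] by auto

lemma sentence_letter: "sentence_of letters (letter n)" "sentence_of letters (Neg (letter n))"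
  by (auto simp: sentence_of_def letter_def letters_def)

lemma proves_letter: "n \<in> B \<Longrightarrow> axioms (letter_theory B C) \<turnstile> letter n"
  by (subst proves_letter_theory[OF sentence_letter(1)]) (auto simp: letter_def)

lemma proves_Neg_letter: "n \<in> C \<Longrightarrow> axioms (letter_theory B C) \<turnstile> Neg (letter n)"
  by (subst proves_letter_theory[OF sentence_letter(2)]) (auto simp: letter_def)

lemma not_interprets_letter_theory: "B \<inter> C = {} \<Longrightarrow> \<not> interprets (letter_theory B C) theory_R"
  using one_element_model_not_interprets_R[of "letter_theory B C" B]
    truth_letter_theory[of _ B C B] by auto

section \<open>Codes of formulas over the letters\<close>

lemma tm_code_inject: "tm_code s = tm_code t \<Longrightarrow> s = t"
proof (induction s arbitrary: t)
  case (Var n)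
  then show ?case by (cases t) auto
next
  case (Fun f ts)
  from Fun.prems obtain ts' where t: "t = Fun f ts'" and eq: "map tm_code ts = map tm_code ts'"
    by (cases t) (auto simp: list_encode_eq)
  have "ts = ts'" using eq Fun.IH by (metis list.inj_map_strong)
  with t show ?case by simp
qed

lemma fm_code_inject: "fm_code \<phi> = fm_code \<psi> \<Longrightarrow> \<phi> = \<psi>"
proof (induction \<phi> arbitrary: \<psi>)
  case (Rel r ts)
  from Rel.prems obtain ts' where \<psi>: "\<psi> = Rel r ts'" and eq: "map tm_code ts = map tm_code ts'"
    by (cases \<psi>) (auto simp: list_encode_eq)
  have "ts = ts'" using eq tm_code_inject by (metis list.inj_map_strong)
  with \<psi> show ?case by simp
next
  case (Imp \<phi>1 \<phi>2)
  then show ?case by (cases \<psi>) auto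
next
  case (All \<phi>)
  then show ?case by (cases \<psi>) auto
next
  case Falsum
  then show ?case by (cases \<psi>) auto
next
  case (Eq s t)
  then show ?case by (cases \<psi>) (auto dest: tm_code_inject)
qed

lemma fm_code_mem_iff: "fm_code \<phi> \<in> fm_code ` A \<longleftrightarrow> \<phi> \<in> A"
  using fm_code_inject by blast

text \<open>The least strict upper bound on the free variables of a formula over \<^const>\<open>letters\<close>; the value
  at other formulas is irrelevant.\<close>

primrec free_bound :: "fm \<Rightarrow> nat" where
  "free_bound Falsum = 0"
| "free_bound (Eq s t) =
    (case s of Var m \<Rightarrow> (case t of Var n \<Rightarrow> Suc (max m n) | _ \<Rightarrow> 0) | _ \<Rightarrow> 0)"
| "free_bound (Rel r ts) = 0"
| "free_bound (Imp \<phi> \<psi>) = max (free_bound \<phi>) (free_bound \<psi>)"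
| "free_bound (All \<phi>) = free_bound \<phi> - 1"

lemma syms_tm_letters: "syms_tm t \<subseteq> letters \<longleftrightarrow> (\<exists>n. t = Var n)"
  by (cases t) (auto simp: letters_def)

text \<open>The bound \<open>k\<close> is general for the sake of the quantifier, which passes to
  \<open>Suc k\<close>; at \<open>k = 0\<close> the equivalence recognizes sentences.\<close>

lemma free_subset_iff_free_bound:
  "syms \<phi> \<subseteq> letters \<Longrightarrow> free \<phi> \<subseteq> {..<k} \<longleftrightarrow> free_bound \<phi> \<le> k"
proof (induction \<phi> arbitrary: k)
  case (Eq s t)
  then obtain m n where "s = Var m" "t = Var n" by (auto simp: syms_tm_letters)
  then show ?case by auto
next
  case (Rel r ts)
  then have "ts = []" by (auto simp: letters_def)
  then show ?case by simp
next
  case (All \<phi>)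
  have "free (All \<phi>) \<subseteq> {..<k} \<longleftrightarrow> free \<phi> \<subseteq> {..<Suc k}"
    by (auto simp: subset_iff) (metis Suc_less_eq not0_implies_Suc zero_less_Suc)
  with All show ?case by auto
qed auto

text \<open>Over \<open>letters\<close> all terms are variables (tag 0) and all argument lists are
  empty (code 0), so no recursion on terms is needed. A first component 0 marks a rejected code;
  \<open>I\<close> supplies the results at smaller codes.\<close>

definition code_info_step ::
  "nat \<Rightarrow> (nat \<Rightarrow> nat \<times> nat \<times> nat) \<Rightarrow> nat \<Rightarrow> nat \<times> nat \<times> nat" where
  "code_info_step w I c =
     (if tag c = 0 \<and> arg c = 0 then (1, 0, 0)
      else if tag c = 1 \<and> tag (arg1 c) = 0 \<and> tag (arg2 c) = 0 then
        (1, Suc (if arg (arg1 c) \<le> arg (arg2 c) then arg (arg2 c) else arg (arg1 c)), 1)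
      else if tag c = 2 \<and> arg2 c = 0 then
        (1, 0, if arg1 c \<in> set_decode w then 1 else 0)
      else if tag c = 3 \<and> fst (I (arg1 c)) = 1 \<and> fst (I (arg2 c)) = 1 then
        (1, if fst (snd (I (arg1 c))) \<le> fst (snd (I (arg2 c)))
            then fst (snd (I (arg2 c))) else fst (snd (I (arg1 c))),
         if snd (snd (I (arg1 c))) = 1 then snd (snd (I (arg2 c))) else 1)
      else if tag c = 4 \<and> fst (I (arg c)) = 1 then
        (1, fst (snd (I (arg c))) - 1, snd (snd (I (arg c))))
      else (0, 0, 0))"

text \<open>For the code of a formula over \<^const>\<open>letters\<close>: 1, its \<^const>\<open>free_bound\<close>, and its truth value
  under the valuation with code \<open>w\<close>.\<close>

function code_info :: "nat \<Rightarrow> nat \<Rightarrow> nat \<times> nat \<times> nat" where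
  "code_info w c = code_info_step w (\<lambda>d. if d < c then code_info w d else (0, 0, 0)) c"
  by auto
termination by (relation "measure snd") auto

declare code_info.simps [simp del]

lemma less_prod_encode_Suc: "x < prod_encode (Suc a, prod_encode (x, y))"
    "y < prod_encode (Suc a, prod_encode (x, y))" "z < prod_encode (Suc a, z)"
  using arg1_less[of "prod_encode (Suc a, prod_encode (x, y))"]
    arg2_less[of "prod_encode (Suc a, prod_encode (x, y))"] arg_less[of "prod_encode (Suc a, z)"]
  by simp_all

lemma less_prod_encode_numeral [simp]:
    "x < prod_encode (3, prod_encode (x, y))" "y < prod_encode (3, prod_encode (x, y))"
    "z < prod_encode (4, z)" "x < prod_encode (2, prod_encode (x, y))"
  using less_prod_encode_Suc(1)[of x 2 y] less_prod_encode_Suc(1)[of x 1 y]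
    less_prod_encode_Suc(2)[of y 2 x] less_prod_encode_Suc(3)[of z 3]
  by (simp_all add: eval_nat_numeral)

lemma code_info_fm_code:
  "syms \<phi> \<subseteq> letters \<Longrightarrow>
    code_info w (fm_code \<phi>) = (1, free_bound \<phi>, of_bool (truth (set_decode w) \<phi>))"
proof (induction \<phi>)
  case (Eq s t)
  then obtain m n where "s = Var m" "t = Var n" by (auto simp: syms_tm_letters)
  then show ?case by (simp add: code_info.simps[of w "prod_encode _"] code_info_step_def)
next
  case (Rel r ts)
  then have "ts = []" by (auto simp: letters_def)
  then show ?case by (simp add: code_info.simps[of w "prod_encode _"] code_info_step_def)
next
  case (Imp \<phi> \<psi>)
  then show ?case
    by (simp add: code_info.simps[of w "prod_encode (3, _)"] code_info_step_def)
qed (simp_all add: code_info.simps[of w "prod_encode _"] code_info_step_def)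

text \<open>Lets the decision procedure reject numbers that code no formula over
  \<open>letters\<close>.\<close>

lemma code_info_valid:
  "fst (code_info w c) = 1 \<Longrightarrow> \<exists>\<phi>. fm_code \<phi> = c \<and> syms \<phi> \<subseteq> letters"
proof (induction c rule: less_induct)
  case (less c)
  obtain a b where c: "c = prod_encode (a, b)" by (rule prod_encode_code_cases)
  obtain b1 b2 where b: "b = prod_encode (b1, b2)" by (rule prod_encode_code_cases)
  note info = less.prems[unfolded code_info.simps[of w c]]
  have "a = 0 \<or> a = 1 \<or> a = 2 \<or> a = 3 \<or> a = 4"
    by (rule ccontr) (use info in \<open>simp add: code_info_step_def c\<close>)
  then consider "a = 0" | "a = 1" | "a = 2" | "a = 3" | "a = 4" by blast
  then show ?case
  proof cases
    case 1
    with info have "b = 0" by (simp add: code_info_step_def c split: if_splits)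
    with 1 show ?thesis by (intro exI[of _ Falsum]) (simp add: c)
  next
    case 2
    with info have "tag b1 = 0" "tag b2 = 0"
      by (simp_all add: code_info_step_def c b split: if_splits)
    then have "b1 = prod_encode (0, arg b1)" "b2 = prod_encode (0, arg b2)"
      by (metis encode_tag_arg)+
    with 2 show ?thesis
      by (intro exI[of _ "Eq (Var (arg b1)) (Var (arg b2))"]) (simp add: c b)
  next
    case 3
    with info have "b2 = 0" by (simp add: code_info_step_def c b split: if_splits)
    with 3 show ?thesis by (intro exI[of _ "letter b1"]) (simp add: c b letter_def letters_def)
  next
    case 4
    with info have "fst (code_info w b1) = 1" "fst (code_info w b2) = 1"
      by (simp_all add: code_info_step_def c b split: if_splits)
    with less.IH[of b1] less.IH[of b2] 4 obtain \<phi> \<psi> where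
      "fm_code \<phi> = b1" "syms \<phi> \<subseteq> letters" "fm_code \<psi> = b2" "syms \<psi> \<subseteq> letters"
      by (auto simp: c b)
    with 4 show ?thesis by (intro exI[of _ "Imp \<phi> \<psi>"]) (simp add: c b)
  next
    case 5
    with info have "fst (code_info w b) = 1"
      by (simp add: code_info_step_def c split: if_splits)
    with less.IH[of b] 5 obtain \<phi> where "fm_code \<phi> = b" "syms \<phi> \<subseteq> letters" by (auto simp: c)
    with 5 show ?thesis by (intro exI[of _ "All \<phi>"]) (simp add: c)
  qed
qed

lemma computable_code_info [comp_intro]:
  assumes "computable X f" "computable X g"
  shows "computable X (\<lambda>x. code_info (f x) (g x))"
proof (rule computable_comp2[OF _ assms])
  let ?G = "\<lambda>w c l. code_info_step w
    (\<lambda>d. if d < c then hd (drop (c - Suc d) l) else (0, 0, 0)) c"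
  show "computable X (\<lambda>p. code_info (fst p) (snd p))"
  proof (rule computable_course_of_values[where G = ?G])
    show "computable X (\<lambda>p. ?G (fst p) (fst (snd p)) (snd (snd p)))"
      unfolding code_info_step_def by (intro comp_intro)
    show "code_info w c = ?G w c (rev (map (code_info w) [0..<c]))" for w c
    proof -
      have "(\<lambda>d. if d < c then hd (drop (c - Suc d) (rev (map (code_info w) [0..<c]))) else (0, 0, 0)) =
          (\<lambda>d. if d < c then code_info w d else (0, 0, 0))"
        using hd_drop_rev_map[of _ c "code_info w"] by auto
      then show ?thesis by (simp only: code_info.simps[of w c])
    qed
  qed
qed

text \<open>Turns validity of a formula into a question about finitely many valuations, bounded by
  its own code.\<close>

lemma letter_less_fm_code: "RelSym r k \<in> syms \<phi> \<Longrightarrow> syms \<phi> \<subseteq> letters \<Longrightarrow> r < fm_code \<phi>"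
proof (induction \<phi>)
  case (Eq s t)
  then show ?case by (auto simp: syms_tm_letters)
next
  case (Rel r' ts)
  then have "ts = []" by (auto simp: letters_def)
  with Rel show ?case by simp
next
  case (Imp \<phi> \<psi>)
  then show ?case by (auto intro: less_trans)
next
  case (All \<phi>)
  then show ?case by (auto intro: less_trans)
qed auto

text \<open>Provability of the formula with code \<open>c\<close> in terms of valuations of the letters below \<open>c\<close>, which
  include all letters in the formula.\<close>

definition provable_code :: "(nat \<Rightarrow> bool) \<Rightarrow> (nat \<Rightarrow> bool) \<Rightarrow> nat \<Rightarrow> bool" where
  "provable_code P N c \<longleftrightarrow> fst (code_info 0 c) = 1 \<and> fst (snd (code_info 0 c)) = 0 \<and>
     (\<forall>w<2 ^ c. (\<forall>m<c. (P m \<longrightarrow> m \<in> set_decode w) \<and> (N m \<longrightarrow> m \<notin> set_decode w)) \<longrightarrow>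
       snd (snd (code_info w c)) = 1)"

text \<open>Guarantees that a search below \<open>2 ^ c\<close> meets every valuation of the letters
  below \<open>c\<close>.\<close>

lemma set_encode_less_pow2: "A \<subseteq> {..<n} \<Longrightarrow> set_encode A < 2 ^ n"
proof -
  assume "A \<subseteq> {..<n}"
  then have "set_encode A \<le> (\<Sum>i<n. 2 ^ i)" unfolding set_encode_def by (intro sum_mono2) auto
  also have "\<dots> < 2 ^ n" by (induction n) auto
  finally show ?thesis .
qed

text \<open>Only letters below \<open>c\<close> matter, and a valuation respecting \<open>B\<close>
  and \<open>C\<close> there extends to one respecting them everywhere.\<close>

lemma provable_set_letter_theory:
  assumes "B \<inter> C = {}"
  shows "c \<in> provable_set (letter_theory B C) \<longleftrightarrow> provable_code (\<lambda>m. m \<in> B) (\<lambda>m. m \<in> C) c"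
proof (cases "\<exists>\<phi>. fm_code \<phi> = c \<and> syms \<phi> \<subseteq> letters")
  case False
  then have "\<not> provable_code (\<lambda>m. m \<in> B) (\<lambda>m. m \<in> C) c"
    using code_info_valid[of 0 c] by (auto simp: provable_code_def)
  moreover have "c \<notin> provable_set (letter_theory B C)"
    using False by (auto simp: provable_set_def sentence_of_def)
  ultimately show ?thesis by simp
next
  case True
  then obtain \<phi> where c: "c = fm_code \<phi>" and syms: "syms \<phi> \<subseteq> letters" by auto
  have sentence: "sentence_of letters \<phi> \<longleftrightarrow> free_bound \<phi> = 0"
    using free_subset_iff_free_bound[OF syms, of 0] syms by (simp add: sentence_of_def)
  have below: "truth v \<phi> \<longleftrightarrow> truth v' \<phi>" if "v \<inter> {..<c} = v' \<inter> {..<c}" for v v'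
    by (rule truth_cong) (use that letter_less_fm_code[OF _ syms] in \<open>auto simp: c\<close>)
  have "(\<forall>v. B \<subseteq> v \<and> C \<inter> v = {} \<longrightarrow> truth v \<phi>) \<longleftrightarrow>
    (\<forall>w<2 ^ c. (\<forall>m<c. (m \<in> B \<longrightarrow> m \<in> set_decode w) \<and> (m \<in> C \<longrightarrow> m \<notin> set_decode w)) \<longrightarrow>
       truth (set_decode w) \<phi>)" (is "?L \<longleftrightarrow> ?R")
  proof
    assume L: ?L
    show ?R
    proof (intro allI impI)
      fix w :: nat
      assume w: "\<forall>m<c. (m \<in> B \<longrightarrow> m \<in> set_decode w) \<and> (m \<in> C \<longrightarrow> m \<notin> set_decode w)"
      \<comment> \<open>From \<open>c\<close> on the valuation copies \<open>B\<close>, which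
        respects \<open>C\<close> by disjointness.\<close>
      let ?v = "(set_decode w \<inter> {..<c}) \<union> (B - {..<c})"
      have "B \<subseteq> ?v" "C \<inter> ?v = {}" using w assms by auto
      with L have "truth ?v \<phi>" by blast
      then show "truth (set_decode w) \<phi>" using below[of ?v "set_decode w"] by auto
    qed
  next
    assume R: ?R
    show ?L
    proof (intro allI impI, elim conjE)
      fix v assume v: "B \<subseteq> v" "C \<inter> v = {}"
      let ?w = "set_encode (v \<inter> {..<c})"
      have w: "set_decode ?w = v \<inter> {..<c}" by simp
      have "?w < 2 ^ c" by (rule set_encode_less_pow2) simp
      moreover have "\<forall>m<c. (m \<in> B \<longrightarrow> m \<in> set_decode ?w) \<and> (m \<in> C \<longrightarrow> m \<notin> set_decode ?w)"
        using v by (auto simp: w)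
      ultimately have "truth (set_decode ?w) \<phi>" using R by blast
      then show "truth v \<phi>" using below[of v "v \<inter> {..<c}"] by (simp add: w)
    qed
  qed
  moreover have "c \<in> provable_set (letter_theory B C) \<longleftrightarrow>
      sentence_of letters \<phi> \<and> (\<forall>v. B \<subseteq> v \<and> C \<inter> v = {} \<longrightarrow> truth v \<phi>)"
    unfolding provable_set_def c fm_code_mem_iff using proves_letter_theory by auto
  moreover have "provable_code (\<lambda>m. m \<in> B) (\<lambda>m. m \<in> C) c \<longleftrightarrow> free_bound \<phi> = 0 \<and>
    (\<forall>w<2 ^ c. (\<forall>m<c. (m \<in> B \<longrightarrow> m \<in> set_decode w) \<and> (m \<in> C \<longrightarrow> m \<notin> set_decode w)) \<longrightarrow>
       truth (set_decode w) \<phi>)"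
    unfolding provable_code_def c code_info_fm_code[OF syms]
    by (simp only: fst_conv snd_conv of_bool_eq_1_iff simp_thms)
  ultimately show ?thesis using sentence by simp
qed

text \<open>More prescribed letters leave fewer valuations to check.\<close>

lemma provable_code_mono:
  "provable_code P N c \<Longrightarrow> (\<And>m. P m \<Longrightarrow> P' m) \<Longrightarrow> (\<And>m. N m \<Longrightarrow> N' m) \<Longrightarrow> provable_code P' N' c"
  unfolding provable_code_def by blast

lemma provable_code_cong:
  "(\<And>m. m < c \<Longrightarrow> P m \<longleftrightarrow> P' m) \<Longrightarrow> (\<And>m. m < c \<Longrightarrow> N m \<longleftrightarrow> N' m) \<Longrightarrow>
    provable_code P N c \<longleftrightarrow> provable_code P' N' c"
  unfolding provable_code_def by simp

lemma recursive_set_letters: "recursive_set (sym_code ` letters)"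
proof -
  have "n \<in> sym_code ` letters \<longleftrightarrow> tag n = 1 \<and> arg2 n = 0" for n
  proof
    assume "tag n = 1 \<and> arg2 n = 0"
    then have "n = sym_code (RelSym (arg1 n) 0)" using encode_tag_args[of n] by simp
    then show "n \<in> sym_code ` letters" unfolding letters_def by blast
  qed (auto simp: letters_def)
  moreover have "decidable {} (\<lambda>n. tag n = 1 \<and> arg2 n = 0)" by (intro comp_intro)
  ultimately show ?thesis by (simp add: recursive_set_iff)
qed

lemma computable_fm_code_letter [comp_intro]:
  "computable X f \<Longrightarrow> computable X (\<lambda>x. fm_code (letter (f x)))"
  by (simp add: letter_def) (intro comp_intro)

section \<open>Turing reducibility and degrees\<close>

primrec replace_oracle :: "prog \<Rightarrow> prog \<Rightarrow> prog" where
  "replace_oracle q PZero = PZero"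
| "replace_oracle q PSucc = PSucc"
| "replace_oracle q (PProj i) = PProj i"
| "replace_oracle q POracle = q"
| "replace_oracle q (PComp f gs) = PComp (replace_oracle q f) (map (replace_oracle q) gs)"
| "replace_oracle q (PPrec f g) = PPrec (replace_oracle q f) (replace_oracle q g)"
| "replace_oracle q (PMu f) = PMu (replace_oracle q f)"

text \<open>Since \<open>q\<close> answers every query, queries inside recursions and searches can
  be replaced as well. This yields transitivity of \<open>\<le>\<^sub>T\<close>.\<close>

lemma computes_replace_oracle:
  assumes "computes_char Y q X" "computes X p xs y"
  shows "computes Y (replace_oracle q p) xs y"
  using assms(2)
proof (induction rule: computes.induct)
  case (orac x)
  then show ?case using assms(1) by (simp add: computes_char_def)
next
  case (comp xs gs ys f z)
  then show ?case
    by (auto intro!: computes.comp[where ys = ys] simp: list_all2_conv_all_nth)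
next
  case (mu f n xs)
  then show ?case by (auto intro!: computes.mu)
qed (auto intro: computes.intros)

lemma turing_le_trans: "A \<le>\<^sub>T B \<Longrightarrow> B \<le>\<^sub>T C \<Longrightarrow> A \<le>\<^sub>T C"
  unfolding turing_le_def computes_char_def
  by (metis computes_replace_oracle[unfolded computes_char_def])

lemma recursive_set_iff_turing_le: "recursive_set A \<longleftrightarrow> A \<le>\<^sub>T {}"
  by (simp add: recursive_set_iff turing_le_iff)

lemma turing_le_recursive: "A \<le>\<^sub>T B \<Longrightarrow> recursive_set B \<Longrightarrow> recursive_set A"
  unfolding recursive_set_iff_turing_le by (rule turing_le_trans)

lemma turing_degree_eq: "A \<le>\<^sub>T B \<Longrightarrow> B \<le>\<^sub>T A \<Longrightarrow> turing_degree A = turing_degree B"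
  unfolding turing_degree_def using turing_le_trans by blast

lemma W_of_decidable:
  assumes "decidable {} P" shows "\<exists>j. W j = {x. P x}"
proof -
  have "decidable {} (\<lambda>p::nat \<times> nat. P (fst p))" by (intro decidable_comp[OF assms] comp_intro)
  from W_semidecidable[OF this] show ?thesis by simp
qed

section \<open>A pair of recursively inseparable sets below a given RE set\<close>

text \<open>Choosing the least stage gives each element a unique moment of entry, on which the
  disjointness of \<open>pos\<close> and \<open>neg\<close> rests.\<close>

definition enters :: "nat \<Rightarrow> nat \<Rightarrow> nat \<Rightarrow> bool" where
  "enters e n t \<longleftrightarrow> halts_by e n t \<and> (\<forall>t'<t. \<not> halts_by e n t')"

text \<open>Here \<open>m\<close> codes a pair \<open>(j, n)\<close>. The verdict compares
  \<open>W j\<close> with the entry stage of \<open>n\<close>; \<open>s\<close> only bounds the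
  search for that stage, so a verdict is final.\<close>

definition pos_at :: "nat \<Rightarrow> nat \<Rightarrow> nat \<Rightarrow> bool" where
  "pos_at e s m \<longleftrightarrow> (\<exists>t<s. enters e (snd (prod_decode m)) t \<and>
     \<not> (\<exists>t'<t. halts_by (fst (prod_decode m)) m t'))"

definition neg_at :: "nat \<Rightarrow> nat \<Rightarrow> nat \<Rightarrow> bool" where
  "neg_at e s m \<longleftrightarrow> (\<exists>t<s. enters e (snd (prod_decode m)) t \<and>
     (\<exists>t'<t. halts_by (fst (prod_decode m)) m t'))"

definition pos :: "nat \<Rightarrow> nat set" where "pos e = {m. \<exists>s. pos_at e s m}"
definition neg :: "nat \<Rightarrow> nat set" where "neg e = {m. \<exists>s. neg_at e s m}"

lemma enters_unique: "enters e n t \<Longrightarrow> enters e n t' \<Longrightarrow> t = t'"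
  unfolding enters_def by (metis linorder_neqE_nat)

lemma W_iff_enters: "n \<in> W e \<longleftrightarrow> (\<exists>t. enters e n t)"
proof
  assume "n \<in> W e"
  then have "\<exists>t. halts_by e n t" by (simp add: W_iff_halts_by)
  then show "\<exists>t. enters e n t" unfolding enters_def by (rule exists_least_iff[THEN iffD1])
qed (auto simp: W_iff_halts_by enters_def)

lemma pos_neg_disjoint: "pos e \<inter> neg e = {}"
  unfolding pos_def neg_def pos_at_def neg_at_def using enters_unique by blast

lemma decidable_pos_at [comp_intro]:
  assumes "computable X f" "computable X g" "computable X h"
  shows "decidable X (\<lambda>x. pos_at (f x) (g x) (h x))"
  by (rule decidable_comp3[OF _ assms]) (unfold pos_at_def enters_def, intro comp_intro)

lemma decidable_neg_at [comp_intro]: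
  assumes "computable X f" "computable X g" "computable X h"
  shows "decidable X (\<lambda>x. neg_at (f x) (g x) (h x))"
  by (rule decidable_comp3[OF _ assms]) (unfold neg_at_def enters_def, intro comp_intro)

text \<open>The oracle is arbitrary so that the argument serves both persistence, with an extension
  as oracle, and inseparability, with the empty one.\<close>

lemma RE_separator_computes_W:
  assumes D: "pos e \<subseteq> W j" "neg e \<inter> W j = {}" and dec: "decidable X (\<lambda>m. m \<in> W j)"
  shows "W e \<le>\<^sub>T X"
proof -
  define m where "m n = prod_encode (j, n)" for n
  \<comment> \<open>If \<open>m n\<close> is outside \<open>W j\<close>, any stage qualifies and the
    search returns 0; the implication makes \<open>t\<close> total.\<close>
  define t where "t n = (LEAST t. m n \<in> W j \<longrightarrow> halts_by j (m n) t)" for n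
  have "decidable X (\<lambda>p. m (fst p) \<in> W j \<longrightarrow> halts_by j (m (fst p)) (snd p))"
    unfolding m_def by (intro comp_intro decidable_comp[OF dec])
  moreover have ex: "\<exists>t. m n \<in> W j \<longrightarrow> halts_by j (m n) t" for n
    by (simp add: W_iff_halts_by)
  ultimately have t: "computable X t" unfolding t_def by (rule computable_Least)
  \<comment> \<open>Membership of \<open>m n\<close> alone proves nothing, as a separator is free
    outside both sets. But an entry of \<open>n\<close> after stage \<open>t n\<close> would have
    put \<open>m n\<close> into \<open>neg e\<close>. \<open>Suc\<close> allows the entry to happen
    at \<open>t n\<close> itself.\<close>
  have "n \<in> W e \<longleftrightarrow> m n \<in> W j \<and> (\<exists>s<Suc (t n). halts_by e n s)" for n
  proof
    assume "n \<in> W e"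
    then obtain s where s: "enters e n s" by (auto simp: W_iff_enters)
    have early: "\<not> halts_by j (m n) s'" if "s' < s" for s'
    proof
      assume "halts_by j (m n) s'"
      then have "m n \<in> neg e \<inter> W j" using s that
        by (auto simp: neg_def neg_at_def m_def W_iff_halts_by)
      with D(2) show False by simp
    qed
    then have "m n \<in> pos e" using s by (auto simp: pos_def pos_at_def m_def)
    with D(1) have mem: "m n \<in> W j" by auto
    moreover have "halts_by j (m n) (t n)" using LeastI_ex[OF ex[of n]] mem by (simp add: t_def)
    then have "s \<le> t n" using early by (metis not_le)
    ultimately show "m n \<in> W j \<and> (\<exists>s<Suc (t n). halts_by e n s)"
      using s by (auto simp: enters_def less_Suc_eq_le)
  qed (auto simp: W_iff_halts_by)
  moreover have "decidable X (\<lambda>n. m n \<in> W j \<and> (\<exists>s<Suc (t n). halts_by e n s))"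
    unfolding m_def by (intro comp_intro decidable_comp[OF dec] computable_comp[OF t])
  ultimately show ?thesis by (simp add: turing_le_iff)
qed

section \<open>The theory of a given degree\<close>

definition T_of :: "nat \<Rightarrow> fo_theory" where "T_of e = letter_theory (pos e) (neg e)"

text \<open>Serves twice: searched over \<open>s\<close> it enumerates the theorems, and at a stage
  found with the oracle \<open>W e\<close> it decides them.\<close>

definition provable_at :: "nat \<Rightarrow> nat \<Rightarrow> nat \<Rightarrow> bool" where
  "provable_at e c s \<longleftrightarrow> provable_code (pos_at e s) (neg_at e s) c"

lemma provable_at_sound: "provable_at e c s \<Longrightarrow> c \<in> provable_set (T_of e)"
  unfolding provable_at_def T_of_def provable_set_letter_theory[OF pos_neg_disjoint]
  by (erule provable_code_mono) (auto simp: pos_def neg_def)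

text \<open>Past the entry stages of all relevant \<open>n\<close>, the approximations agree with
  \<open>pos e\<close> and \<open>neg e\<close> below \<open>c\<close>, and nothing else is
  consulted.\<close>

lemma provable_at_complete:
  assumes s: "\<And>m. m < c \<Longrightarrow> snd (prod_decode m) \<in> W e \<Longrightarrow> \<exists>t<s. halts_by e (snd (prod_decode m)) t"
  shows "provable_at e c s \<longleftrightarrow> c \<in> provable_set (T_of e)"
proof -
  have bound: "t < s" if "m < c" "enters e (snd (prod_decode m)) t" for m t
  proof -
    from that have "snd (prod_decode m) \<in> W e" by (auto simp: W_iff_enters)
    from s[OF that(1) this] obtain t' where "t' < s" "halts_by e (snd (prod_decode m)) t'" by blast
    with that(2) show ?thesis unfolding enters_def by (meson le_less_trans not_le)
  qed
  show ?thesis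
    unfolding provable_at_def T_of_def provable_set_letter_theory[OF pos_neg_disjoint]
    using bound by (intro provable_code_cong) (auto simp: pos_def neg_def pos_at_def neg_at_def)
qed

lemma W_stage_exists:
  "\<exists>s. \<forall>m<c. snd (prod_decode m) \<in> W e \<longrightarrow> (\<exists>t<s. halts_by e (snd (prod_decode m)) t)"
proof (induction c)
  case (Suc c)
  then obtain s where s: "\<forall>m<c. snd (prod_decode m) \<in> W e \<longrightarrow>
    (\<exists>t<s. halts_by e (snd (prod_decode m)) t)" by blast
  obtain t where "snd (prod_decode c) \<in> W e \<longrightarrow> halts_by e (snd (prod_decode c)) t"
    using W_iff_halts_by by blast
  with s have "\<forall>m<Suc c. snd (prod_decode m) \<in> W e \<longrightarrow>
    (\<exists>t'<max s (Suc t). halts_by e (snd (prod_decode m)) t')"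
    by (auto simp: less_Suc_eq less_max_iff_disj)
  then show ?case by blast
qed simp

lemma decidable_provable_at [comp_intro]:
  assumes "computable X f" "computable X g" "computable X h"
  shows "decidable X (\<lambda>x. provable_at (f x) (g x) (h x))"
  by (rule decidable_comp3[OF _ assms])
    (unfold provable_at_def provable_code_def, intro comp_intro)

lemma provable_set_T_of: "provable_set (T_of e) = {c. \<exists>s. provable_at e c s}"
proof (intro set_eqI iffI; unfold mem_Collect_eq)
  fix c assume c: "c \<in> provable_set (T_of e)"
  from W_stage_exists[of c e] obtain s where
    "\<And>m. m < c \<Longrightarrow> snd (prod_decode m) \<in> W e \<Longrightarrow> \<exists>t<s. halts_by e (snd (prod_decode m)) t" by blast
  with c provable_at_complete show "\<exists>s. provable_at e c s" by blast
qed (auto dest: provable_at_sound)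

lemma provable_set_T_of_turing_le: "provable_set (T_of e) \<le>\<^sub>T W e"
proof -
  \<comment> \<open>The oracle tells which \<open>n\<close> are worth waiting for, so this search
    terminates.\<close>
  define s where "s c = (LEAST s. \<forall>m<c. snd (prod_decode m) \<in> W e \<longrightarrow>
    (\<exists>t<s. halts_by e (snd (prod_decode m)) t))" for c
  have "computable (W e) s" unfolding s_def
    by (rule computable_Least[OF _ W_stage_exists]) (intro comp_intro decidable_oracle)
  then have "decidable (W e) (\<lambda>c. provable_at e c (s c))"
    by (intro comp_intro)
  moreover have "provable_at e c (s c) \<longleftrightarrow> c \<in> provable_set (T_of e)" for c
    using LeastI_ex[OF W_stage_exists[of c e]] by (intro provable_at_complete) (auto simp: s_def)
  ultimately show ?thesis by (simp add: turing_le_iff)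
qed

text \<open>The letters provable in \<open>S\<close> form an RE separator: consistency keeps the
  refutable ones out. The rest of the language of \<open>S\<close> is never consulted.\<close>

lemma extension_computes_W:
  assumes S: "RE_theory S" "consistent S" "extends S (T_of e)"
  shows "W e \<le>\<^sub>T provable_set S"
proof -
  define D where "D = {m. fm_code (letter m) \<in> provable_set S}"
  obtain k where k: "provable_set S = W k" using S(1) by (auto simp: RE_theory_def RE_set_def)
  have "decidable {} (\<lambda>p. halts_by k (fm_code (letter (fst p))) (snd p))" by (intro comp_intro)
  from W_semidecidable[OF this] obtain j where j: "W j = D"
    by (auto simp: D_def k W_iff_halts_by)
  have mem: "m \<in> D \<longleftrightarrow> letter m \<in> theorems S" for m
    unfolding D_def provable_set_def by (simp add: fm_code_mem_iff theorems_def)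
  have thms: "theorems (T_of e) \<subseteq> theorems S" using S(3) by (simp add: extends_def)
  have "pos e \<subseteq> D"
  proof
    fix m assume "m \<in> pos e"
    then have "letter m \<in> theorems (T_of e)"
      by (simp add: theorems_def T_of_def proves_letter sentence_letter)
    with thms show "m \<in> D" by (auto simp: mem)
  qed
  moreover have "neg e \<inter> D = {}"
  proof (intro equals0I, elim IntE)
    fix m assume m: "m \<in> neg e" "m \<in> D"
    then have "Neg (letter m) \<in> theorems (T_of e)"
      by (simp add: theorems_def T_of_def proves_Neg_letter sentence_letter)
    with thms have "axioms S \<turnstile> Neg (letter m)" by (auto simp: theorems_def)
    moreover have "axioms S \<turnstile> letter m" using m(2) by (simp add: mem theorems_def)
    ultimately have "axioms S \<turnstile> Falsum" by (rule proves.MP)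
    with S(2) show False by (simp add: consistent_def)
  qed
  moreover have "decidable (provable_set S) (\<lambda>m. m \<in> D)"
    unfolding D_def mem_Collect_eq by (intro decidable_oracle comp_intro)
  ultimately show ?thesis by (intro RE_separator_computes_W[of e j]) (simp_all add: j)
qed

text \<open>\<open>X\<close> need not come from a theory. Its letters form a recursive set, which
  has an RE index and so falls under the same separator argument.\<close>

lemma recursive_separator_decides_W:
  assumes X: "recursive_set X" "provable_set (T_of e) \<subseteq> X" "X \<inter> refutable_set (T_of e) = {}"
  shows "recursive_set (W e)"
proof -
  define D where "D = {m. fm_code (letter m) \<in> X}"
  have dec: "decidable {} (\<lambda>m. m \<in> D)"
    unfolding D_def mem_Collect_eq
    by (intro decidable_comp[OF X(1)[unfolded recursive_set_iff]] comp_intro)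
  from W_of_decidable[OF this] obtain j where j: "W j = D" by auto
  have "fm_code (letter m) \<in> provable_set (T_of e)" if "m \<in> pos e" for m
    using that by (auto simp: provable_set_def T_of_def proves_letter sentence_letter)
  then have "pos e \<subseteq> D" using X(2) by (auto simp: D_def)
  moreover have "fm_code (letter m) \<in> refutable_set (T_of e)" if "m \<in> neg e" for m
    using that by (auto simp: refutable_set_def T_of_def proves_Neg_letter sentence_letter)
  then have "neg e \<inter> D = {}" using X(3) by (auto simp: D_def)
  ultimately have "W e \<le>\<^sub>T {}"
    using dec by (intro RE_separator_computes_W[of e j]) (simp_all add: j)
  then show ?thesis by (simp add: recursive_set_iff_turing_le)
qed

text \<open>A degree is presented by an index of any RE set in it; effectiveness means one recursive
  map from such indices to indices of theories.\<close>

theorem theorem3p14: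
  shows "\<exists>f. recursive_fun f \<and>
    (\<forall>d e. RE_degree d \<and> \<not> recursive_degree d \<and> W e \<in> d \<longrightarrow>
      (\<exists>T. theory_index (f e) T \<and> RE_theory T \<and> consistent T \<and>
        \<not> interprets T theory_R \<and> RI T \<and> TP T \<and> theory_degree T = d))"
proof -
  have "decidable {} (\<lambda>p::nat \<times> nat \<times> nat. provable_at (fst p) (fst (snd p)) (snd (snd p)))"
    by (intro comp_intro)
  from W_uniform[OF this] obtain g where g: "computable {} g"
    and W_g: "\<And>e. W (g e) = provable_set (T_of e)" by (auto simp: provable_set_T_of)
  obtain i where i: "decision_index i (sym_code ` letters)"
    using recursive_set_letters by (auto simp: recursive_set_def decision_index_def)
  show ?thesis
  \<comment> \<open>The language is the same for all \<open>e\<close>, so only the enumeration index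
    varies.\<close>
  proof (intro exI[of _ "\<lambda>e. prod_encode (i, g e)"] conjI allI impI; (elim conjE)?)
    show "recursive_fun (\<lambda>e. prod_encode (i, g e))"
      unfolding recursive_fun_iff by (intro comp_intro g)
    fix d e
    assume d: "RE_degree d" "\<not> recursive_degree d" "W e \<in> d"
    let ?T = "T_of e"
    obtain A where A: "d = turing_degree A" using d(1) by (auto simp: RE_degree_def)
    with d(3) have "W e \<le>\<^sub>T A" "A \<le>\<^sub>T W e" by (auto simp: turing_degree_def)
    then have deg: "turing_degree (W e) = d" unfolding A by (rule turing_degree_eq)
    have nonrec: "\<not> recursive_set (W e)" using d(2) deg by (auto simp: recursive_degree_def)
    have index: "theory_index (prod_encode (i, g e)) ?T"
      using i W_g is_theory_letter_theory unfolding theory_index_def by (auto simp: T_of_def)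
    have RE: "RE_theory ?T"
      using recursive_set_letters is_theory_letter_theory W_g[of e] unfolding RE_theory_def RE_set_def
      by (auto simp: T_of_def)
    have cons: "consistent ?T"
      unfolding T_of_def by (rule consistent_letter_theory[OF pos_neg_disjoint])
    have le: "W e \<le>\<^sub>T provable_set S" if "RE_theory S" "consistent S" "extends S ?T" for S
      using extension_computes_W that .
    \<comment> \<open>The theory is an extension of itself; this gives undecidability and the lower
      bound on its degree.\<close>
    have le_T: "W e \<le>\<^sub>T provable_set ?T" by (rule le[OF RE cons]) (simp add: extends_def)
    have "\<not> interprets ?T theory_R"
      unfolding T_of_def by (rule not_interprets_letter_theory[OF pos_neg_disjoint])
    moreover have "RI ?T" unfolding RI_def using recursive_separator_decides_W nonrec by blast
    \<comment> \<open>Each consistent RE extension computes \<open>W e\<close>, which in turn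
      computes the theory.\<close>
    moreover have "TP ?T" unfolding TP_def undecidable_def
      using le le_T nonrec turing_le_recursive turing_le_trans[OF provable_set_T_of_turing_le] by blast
    moreover have "theory_degree ?T = d"
      unfolding theory_degree_def deg[symmetric]
      by (rule turing_degree_eq[OF provable_set_T_of_turing_le le_T])
    ultimately show "\<exists>T. theory_index (prod_encode (i, g e)) T \<and> RE_theory T \<and> consistent T \<and>
        \<not> interprets T theory_R \<and> RI T \<and> TP T \<and> theory_degree T = d"
      using index RE cons by blast
  qed
qed

end
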